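(* Let $\{W_t\}_{t\in\mathbb{Z}_+}$ be a sequence of discrete channels for which there is a function $g:(0,1)\to\mathbb{R}_+$ such that (i) $\lim_{n\to\infty}\frac1nC_{\alpha,W_{[1,n]}}=g(\alpha)$ for all $\alpha\in(0,1)$; (ii) $\lim_{\alpha\uparrow1}\frac{1-\alpha}{\alpha}g(\alpha)=0$; (iii) there exist $K\in\mathbb{R}_+$ and $n_0\in\mathbb{Z}_+$ with $\sup_{\alpha\in(0,1)}\sup_{t\in\mathbb{Z}_+}|C_{\alpha,W_{[t,t+n-1]}}-ng(\alpha)|\le K\ln n$ for all $n\ge n_0$. Let $0<\alpha_0<\alpha_1<1$. Then for any sequence of codes, the $n$-th being an $(M_n,L_n)$ channel code on the discrete product channel with feedback $W_{\vec{[1,n]}}$ with average error probability $P_e^{(n)}$, satisfying $$C_{\alpha_1,W_{[1,n]}}\ge\ln\frac{M_n}{L_n}\ge C_{\alpha_0,W_{[1,n]}}+(K+1)n^{3/4}\ln n\quad\forall n\ge n_0,$$ there exists $n_1\ge n_0$ such that $$P_e^{(n)}\ge\exp\Big(-E_{sp}\big(\ln\tfrac{M_n}{L_n},W_{[1,n]}\big)-\tfrac{6K+1}{\alpha_0}n^{3/4}\ln n\Big)\quad\forall n\ge n_1.$$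
   Context: A discrete channel is a map from a finite input set to probability distributions on a finite output set. $W_{[t,t+n-1]}$ denotes the product channel (without feedback) with input set $\mathcal{X}_t\times\cdots\times\mathcal{X}_{t+n-1}$ and $W_{[t,t+n-1]}(y|x)=\prod_{s}W_s(y_s|x_s)$. The length $n$ discrete product channel with feedback $W_{\vec{[1,n]}}$ has input set $\mathcal{X}_1\times\prod_{t=2}^n\mathcal{X}_t^{\mathsf{Y}_1\times\cdots\times\mathsf{Y}_{t-1}}$ (inputs $(x_1,e_2,\dots,e_n)$), output set $\mathsf{Y}_1\times\cdots\times\mathsf{Y}_n$, and $W(y|x)=W_1(y_1|x_1)\prod_{t=2}^nW_t(y_t|e_t(y_1,\dots,y_{t-1}))$. An $(M,L)$ channel code: encoder $f:\{1,\dots,M\}\to$ input set, decoder $\psi$ from outputs to $L$-element subsets of $\{1,\dots,M\}$; $P_e=\frac1M\sum_mW(f(m))(\{y:m\notin\psi(y)\})$. Rényi information $I_\alpha(p;W)=\frac{\alpha}{\alpha-1}\ln\sum_y(\sum_xp(x)W(y|x)^\alpha)^{1/\alpha}$ ($\alpha\ne1$), $I_1$ the mutual information; Rényi capacity $C_{\alpha,W}=\sup_pI_\alpha(p;W)$. Sphere packing exponent $E_{sp}(R,W)=\sup_{\alpha\in(0,\infty)}\frac{1-\alpha}{\alpha}(C_{\alpha,W}-R)$. *)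

theory Defs
  imports "HOL-Analysis.Analysis"
begin

definition discrete_channel :: "'x set \<Rightarrow> 'y set \<Rightarrow> ('x \<Rightarrow> 'y \<Rightarrow> real) \<Rightarrow> bool" where
  "discrete_channel X Y W \<longleftrightarrow> finite X \<and> X \<noteq> {} \<and> finite Y \<and> Y \<noteq> {} \<and>
     (\<forall>x\<in>X. (\<forall>y\<in>Y. 0 \<le> W x y) \<and> (\<Sum>y\<in>Y. W x y) = 1)"

definition is_dist :: "'x set \<Rightarrow> ('x \<Rightarrow> real) \<Rightarrow> bool" where
  "is_dist X p \<longleftrightarrow> (\<forall>x\<in>X. 0 \<le> p x) \<and> (\<Sum>x\<in>X. p x) = 1"

definition renyi_info :: "real \<Rightarrow> 'x set \<Rightarrow> 'y set \<Rightarrow> ('x \<Rightarrow> 'y \<Rightarrow> real) \<Rightarrow> ('x \<Rightarrow> real) \<Rightarrow> real" where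
  "renyi_info \<alpha> X Y W p =
     (if \<alpha> = 1 then
        (\<Sum>x\<in>X. \<Sum>y\<in>Y. p x * W x y * ln (W x y / (\<Sum>x'\<in>X. p x' * W x' y)))
      else \<alpha> / (\<alpha> - 1) * ln (\<Sum>y\<in>Y. (\<Sum>x\<in>X. p x * W x y powr \<alpha>) powr (1 / \<alpha>)))"

definition renyi_capacity :: "real \<Rightarrow> 'x set \<Rightarrow> 'y set \<Rightarrow> ('x \<Rightarrow> 'y \<Rightarrow> real) \<Rightarrow> real" where
  "renyi_capacity \<alpha> X Y W = Sup ((\<lambda>p. renyi_info \<alpha> X Y W p) ` {p. is_dist X p})"

text \<open>Sphere packing exponent, valued in the extended reals (it may be +infinity).\<close>
definition sphere_packing_exp :: "real \<Rightarrow> 'x set \<Rightarrow> 'y set \<Rightarrow> ('x \<Rightarrow> 'y \<Rightarrow> real) \<Rightarrow> ereal" where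
  "sphere_packing_exp R X Y W =
     (SUP \<alpha>\<in>{0<..}. ereal ((1 - \<alpha>) / \<alpha> * (renyi_capacity \<alpha> X Y W - R)))"

definition prod_set :: "(nat \<Rightarrow> 'a set) \<Rightarrow> nat \<Rightarrow> nat \<Rightarrow> 'a list set" where
  "prod_set X t n = {xs. length xs = n \<and> (\<forall>i<n. xs ! i \<in> X (t + i))}"

definition prod_kernel :: "(nat \<Rightarrow> 'a \<Rightarrow> 'b \<Rightarrow> real) \<Rightarrow> nat \<Rightarrow> nat \<Rightarrow> 'a list \<Rightarrow> 'b list \<Rightarrow> real" where
  "prod_kernel W t n xs ys = (\<Prod>i<n. W (t + i) (xs ! i) (ys ! i))"

definition prod_capacity :: "real \<Rightarrow> (nat \<Rightarrow> 'a set) \<Rightarrow> (nat \<Rightarrow> 'b set) \<Rightarrow> (nat \<Rightarrow> 'a \<Rightarrow> 'b \<Rightarrow> real) \<Rightarrow> nat \<Rightarrow> nat \<Rightarrow> real" where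
  "prod_capacity \<alpha> X Y W t n = renyi_capacity \<alpha> (prod_set X t n) (prod_set Y t n) (prod_kernel W t n)"

text \<open>Inputs of the length-n product channel with feedback W_[1,n] (arrow):
  an input is a strategy e, where e t (y_1,...,y_{t-1}) is the channel input at time t
  (t = 1..n; for t = 1 the argument is the empty list, giving x_1).\<close>
definition fb_inputs :: "(nat \<Rightarrow> 'a set) \<Rightarrow> (nat \<Rightarrow> 'b set) \<Rightarrow> nat \<Rightarrow> (nat \<Rightarrow> 'b list \<Rightarrow> 'a) set" where
  "fb_inputs X Y n = {e. \<forall>i<n. \<forall>ys\<in>prod_set Y 1 i. e (i + 1) ys \<in> X (i + 1)}"

definition fb_kernel :: "(nat \<Rightarrow> 'a \<Rightarrow> 'b \<Rightarrow> real) \<Rightarrow> nat \<Rightarrow> (nat \<Rightarrow> 'b list \<Rightarrow> 'a) \<Rightarrow> 'b list \<Rightarrow> real" where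
  "fb_kernel W n e ys = (\<Prod>i<n. W (i + 1) (e (i + 1) (take i ys)) (ys ! i))"

definition fb_code :: "(nat \<Rightarrow> 'a set) \<Rightarrow> (nat \<Rightarrow> 'b set) \<Rightarrow> nat \<Rightarrow> nat \<Rightarrow> nat \<Rightarrow>
    (nat \<Rightarrow> nat \<Rightarrow> 'b list \<Rightarrow> 'a) \<Rightarrow> ('b list \<Rightarrow> nat set) \<Rightarrow> bool" where
  "fb_code X Y n M L f \<psi> \<longleftrightarrow> 1 \<le> M \<and> (\<forall>m\<in>{1..M}. f m \<in> fb_inputs X Y n) \<and>
     (\<forall>ys\<in>prod_set Y 1 n. \<psi> ys \<subseteq> {1..M} \<and> card (\<psi> ys) = L)"

definition fb_error :: "(nat \<Rightarrow> 'b set) \<Rightarrow> (nat \<Rightarrow> 'a \<Rightarrow> 'b \<Rightarrow> real) \<Rightarrow> nat \<Rightarrow> nat \<Rightarrow>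
    (nat \<Rightarrow> nat \<Rightarrow> 'b list \<Rightarrow> 'a) \<Rightarrow> ('b list \<Rightarrow> nat set) \<Rightarrow> real" where
  "fb_error Y W n M f \<psi> = (1 / real M) *
     (\<Sum>m\<in>{1..M}. \<Sum>ys\<in>{ys\<in>prod_set Y 1 n. m \<notin> \<psi> ys}. fb_kernel W n (f m) ys)"

end

theory Submission
  imports Defs
begin

text \<open>
  The time axis is cut into blocks of length about \<open>n powr (1/3)\<close>. On a block, every feedback
  strategy induces an output distribution \<open>w\<close> with \<open>D\<^sub>\<alpha>(w \<parallel> q\<^sub>\<alpha>) \<le> C\<^sub>\<alpha>\<close>, where \<open>q\<^sub>\<alpha>\<close> is the product of the
  Renyi centers. Averaging \<open>q\<^sub>\<alpha>\<close> over a grid of at most \<open>n\<close> orders (Augustin's averaging) gives one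
  reference measure \<open>q\<close> that serves all orders at the cost of \<open>ln n\<close> per block. Hence the order \<open>\<alpha>\<close> of
  the tilted measure \<open>V \<propto> w\<^sup>\<alpha> q\<^sup>1\<^sup>-\<^sup>\<alpha>\<close> may depend on the strategy and on the past: it is
  chosen so that \<open>D(V \<parallel> q)\<close> is the share of the rate \<open>ln (M / L)\<close> allotted to the block, and then
  \<open>D(V \<parallel> w) \<le> (1 - \<alpha>) / \<alpha> * (C\<^sub>\<alpha> + ln n - D(V \<parallel> q))\<close> is at most the share of the sphere packing exponent.
  Concentration of the log-likelihood ratios is handled by moments of a small order \<open>s\<close> of \<open>V/q\<close>
  and \<open>V/w\<close>, which multiply along the blocks because their bounds are uniform in the strategy;
  Markov's inequality and a change of measure from \<open>V\<close> to the channel then bound the error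
  probability from below. Since the blocks are few, all losses are of order \<open>n powr (2/3) * ln n\<close>.
\<close>

section \<open>Elementary inequalities\<close>

text \<open>Divided by \<open>b powr r\<close> this is Bernoulli's inequality at
  \<open>a / b\<close>, which is Young's inequality with weights \<open>1/r\<close> and
  \<open>1 - 1/r\<close>. At \<open>b = 0\<close> the left side is 0, since
  \<open>0 powr x = 0\<close> for every exponent, including 0.\<close>

lemma powr_tangent_le:
  fixes a b r :: real
  assumes "0 \<le> a" "0 \<le> b" "1 \<le> r"
  shows "b powr r + r * b powr (r - 1) * (a - b) \<le> a powr r"
proof (cases "b = 0")
  case False
  have bern: "1 + r * (x - 1) \<le> x powr r" if "0 \<le> x" for x :: real
  proof (cases "x = 0")
    case False
    then have "(x powr r) powr (1/r) * 1 powr (1 - 1/r) \<le> 1/r * x powr r + (1 - 1/r) * 1"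
      using assms that by (intro Youngs_inequality_0) auto
    then have "r * x \<le> r * (1/r * x powr r + (1 - 1/r))"
      using assms False that by (intro mult_left_mono) (auto simp: powr_powr)
    also have "r * (1/r * x powr r + (1 - 1/r)) = x powr r + (r - 1)"
      using assms by (simp add: distrib_left right_diff_distrib)
    finally show ?thesis by (simp add: algebra_simps)
  qed (use assms in auto)
  have "b powr r * (1 + r * (a/b - 1)) \<le> b powr r * (a/b) powr r"
    using assms by (intro mult_left_mono bern) auto
  then show ?thesis
    using False assms by (simp add: powr_divide powr_diff field_simps)
qed (use assms in auto)

text \<open>The tangent inequality at the weighted sum \<open>m\<close> is averaged. Total weight
  below one is harmless: the averaged tangents give \<open>m powr p\<close> times
  \<open>sum w S + p * (1 - sum w S)\<close>, and this factor is at least 1.\<close>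

lemma sum_powr_Jensen:
  fixes w z :: "'i \<Rightarrow> real"
  assumes "finite S" "\<And>i. i \<in> S \<Longrightarrow> 0 \<le> w i" "sum w S \<le> 1" "\<And>i. i \<in> S \<Longrightarrow> 0 \<le> z i" "1 \<le> p"
  shows "(\<Sum>i\<in>S. w i * z i) powr p \<le> (\<Sum>i\<in>S. w i * z i powr p)"
proof -
  define m where "m = (\<Sum>i\<in>S. w i * z i)"
  have m: "0 \<le> m" unfolding m_def using assms by (intro sum_nonneg) auto
  have "m powr p \<le> m powr p * (sum w S + p * (1 - sum w S))"
  proof -
    have "0 \<le> (p - 1) * (1 - sum w S)" using assms by auto
    then have "1 \<le> sum w S + p * (1 - sum w S)" by (simp add: algebra_simps)
    then show ?thesis by (simp add: mult_le_cancel_left1)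
  qed
  also have "\<dots> = m powr p * sum w S + p * m powr (p - 1) * (m - m * sum w S)"
  proof (cases "m = 0")
    case False
    then have "m powr p = m * m powr (p - 1)" using m by (simp add: powr_diff)
    then show ?thesis by (simp add: algebra_simps)
  qed auto
  also have "\<dots> = (\<Sum>i\<in>S. w i * (m powr p + p * m powr (p - 1) * (z i - m)))"
  proof -
    have "m - m * sum w S = (\<Sum>i\<in>S. w i * (z i - m))"
      by (simp add: right_diff_distrib sum_subtractf mult.commute flip: m_def sum_distrib_right sum_distrib_left)
    then show ?thesis
      by (simp add: distrib_left sum.distrib sum_distrib_left sum_distrib_right ac_simps)
  qed
  also have "\<dots> \<le> (\<Sum>i\<in>S. w i * z i powr p)"
    using assms m by (intro sum_mono mult_left_mono powr_tangent_le) auto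
  finally show ?thesis unfolding m_def .
qed

lemma exp_le_quadratic_nonpos:
  fixes x :: real assumes "x \<le> 0" shows "exp x \<le> 1 + x + x^2 / 2"
proof -
  have "(\<lambda>y::real. 1 + y + y^2/2 - exp y) 0 \<le> (\<lambda>y. 1 + y + y^2/2 - exp y) x"
    by (rule DERIV_nonpos_imp_nonincreasing[OF assms])
      (auto intro!: derivative_eq_intros exI simp: exp_ge_add_one_self)
  then show ?thesis by simp
qed

lemma exp_le_quadratic_exp:
  fixes x :: real assumes "0 \<le> x" shows "exp x \<le> 1 + x + x^2 / 2 * exp x"
proof -
  have "(\<lambda>y::real. 1 + y + y^2/2 * exp y - exp y) 0 \<le> (\<lambda>y. 1 + y + y^2/2 * exp y - exp y) x"
  proof (rule DERIV_nonneg_imp_nondecreasing[OF assms])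
    fix y :: real assume y: "0 \<le> y" "y \<le> x"
    have "exp y * (1 - y) \<le> exp y * exp (-y)"
      using exp_ge_add_one_self[of "-y"] by (intro mult_left_mono) auto
    then have "exp y - y * exp y \<le> 1"
      by (simp add: algebra_simps flip: exp_add)
    moreover have "0 \<le> y^2/2 * exp y" by simp
    ultimately have "0 \<le> 1 + (y * exp y + y^2/2 * exp y) - exp y" by linarith
    moreover have "((\<lambda>y. 1 + y + y^2/2 * exp y - exp y) has_real_derivative
        (1 + (y * exp y + y^2/2 * exp y) - exp y)) (at y)"
      by (auto intro!: derivative_eq_intros simp: algebra_simps)
    ultimately show "\<exists>D. ((\<lambda>y. 1 + y + y^2/2 * exp y - exp y) has_real_derivative D) (at y) \<and> 0 \<le> D"
      by blast
  qed
  then show ?thesis by simp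
qed

text \<open>Only the lower tails of \<open>x\<close> and \<open>y\<close> are integrable a priori; the coupling
  \<open>x \<le> B (1 + y\<^sup>-)\<close> converts the lower tail of \<open>y\<close> into an upper tail of \<open>x\<close>.\<close>

lemma exp_coupled_tails:
  fixes x y s B :: real
  assumes "0 < s" "1 \<le> B" "s * B \<le> 1/2" "x \<le> B * (1 + max 0 (- y))"
  shows "exp (s * x) \<le> 1 + s * x + s^2 * (exp (- x) + 11 * B^2 * (1 + exp (- y)))"
proof (cases "x \<le> 0")
  case True
  have "exp (s * x) \<le> 1 + s*x + (s*x)^2/2"
    using True assms by (intro exp_le_quadratic_nonpos) (auto simp: mult_le_0_iff)
  also have "(s*x)^2/2 = s^2 * (x^2/2)" by (simp add: power_mult_distrib)
  also have "\<dots> \<le> s^2 * exp (- x)"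
    using exp_lower_Taylor_quadratic[of "-x"] True by (intro mult_left_mono) auto
  also have "\<dots> \<le> s^2 * (exp (- x) + 11 * B^2 * (1 + exp (- y)))"
    by (intro mult_left_mono) (auto intro!: mult_nonneg_nonneg add_nonneg_nonneg)
  finally show ?thesis by simp
next
  case False
  \<comment> \<open>Since \<open>s * B \<le> 1/2\<close>, the exponent \<open>s * x\<close> is at
    most \<open>t / 2\<close>; the other half of \<open>exp t\<close> absorbs the quadratic factor,
    and \<open>exp t\<close> itself is controlled by \<open>exp (- y)\<close>.\<close>
  define t where "t = 1 + max 0 (- y)"
  have t: "1 \<le> t" "x \<le> B * t" using assms by (auto simp: t_def)
  have "exp (s*x) \<le> 1 + s*x + (s*x)^2/2 * exp (s*x)"
    using False assms by (intro exp_le_quadratic_exp) auto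
  also have "(s*x)^2/2 * exp (s*x) = s^2 * (x^2/2 * exp (s*x))" by (simp add: power_mult_distrib)
  also have "x^2/2 * exp (s*x) \<le> (B*t)^2/2 * exp (t/2)"
  proof (intro mult_mono divide_right_mono power_mono)
    have "s * x \<le> s * (B * t)" using t assms by (intro mult_left_mono) auto
    also have "\<dots> \<le> 1/2 * t" using assms t mult_right_mono[of "s*B" "1/2" t] by (simp add: mult.assoc)
    finally show "exp (s*x) \<le> exp (t/2)" by simp
  qed (use t False in auto)
  also have "\<dots> = B^2 * (t^2/2 * exp (t/2))" by (simp add: power_mult_distrib)
  also have "t^2/2 * exp (t/2) \<le> 4 * exp t"
  proof -
    have "(t/2)^2/2 \<le> exp (t/2)" using exp_lower_Taylor_quadratic[of "t/2"] t by simp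
    then have "t^2/2 \<le> 4 * exp (t/2)" by (simp add: power_divide)
    then have "t^2/2 * exp (t/2) \<le> 4 * exp (t/2) * exp (t/2)" by (intro mult_right_mono) auto
    then show ?thesis by (simp add: mult.assoc flip: exp_add)
  qed
  \<comment> \<open>The constant 11 is 4 times 11/4, the latter bounding
    \<open>exp 1\<close>.\<close>
  also have "4 * exp t \<le> 11 * (1 + exp (- y))"
  proof -
    have "exp t = exp 1 * exp (max 0 (-y))" by (simp add: t_def exp_add)
    also have "\<dots> \<le> 11/4 * (1 + exp (-y))"
    proof (intro mult_mono)
      show "exp 1 \<le> (11/4::real)" using e_less_272 by simp
    qed (auto simp: max_def)
    finally show ?thesis using exp_gt_zero[of "-y"] by linarith
  qed
  finally have "exp (s*x) \<le> 1 + s*x + s^2 * (B^2 * (11 * (1 + exp (-y))))"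
    by (simp add: mult_left_mono)
  also have "\<dots> \<le> 1 + s * x + s^2 * (exp (- x) + 11 * B^2 * (1 + exp (- y)))"
    by (intro add_left_mono mult_left_mono) (auto simp: algebra_simps)
  finally show ?thesis .
qed

text \<open>Averaging the pointwise bound leaves a second-order coefficient
  \<open>1 + 22 * B^2\<close>, at most \<open>23 * B^2\<close>. The exponential form comes from
  \<open>1 + z \<le> exp z\<close> and lets the bounds of successive blocks multiply.\<close>

lemma exp_moment_coupled_tails:
  fixes V x y :: "'i \<Rightarrow> real"
  assumes "finite S" "\<And>i. i \<in> S \<Longrightarrow> 0 \<le> V i" "sum V S = 1"
    and "(\<Sum>i\<in>S. V i * exp (- x i)) \<le> 1" "(\<Sum>i\<in>S. V i * exp (- y i)) \<le> 1"
    and sB: "0 < s" "1 \<le> B" "s * B \<le> 1/2" and "\<And>i. i \<in> S \<Longrightarrow> x i \<le> B * (1 + max 0 (- y i))"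
    and mean: "(\<Sum>i\<in>S. V i * x i) \<le> \<mu>"
  shows "(\<Sum>i\<in>S. V i * exp (s * x i)) \<le> exp (s * (\<mu> + 23 * s * B^2))"
proof -
  have "(\<Sum>i\<in>S. V i * exp (s * x i))
      \<le> (\<Sum>i\<in>S. V i * (1 + s * x i + s^2 * (exp (- x i) + 11 * B^2 * (1 + exp (- y i)))))"
    using assms by (intro sum_mono mult_left_mono exp_coupled_tails) auto
  also have "\<dots> = sum V S + s * (\<Sum>i\<in>S. V i * x i) + s^2 * ((\<Sum>i\<in>S. V i * exp (- x i)) +
       11 * B^2 * (sum V S + (\<Sum>i\<in>S. V i * exp (- y i))))"
    by (simp add: algebra_simps sum.distrib sum_distrib_left sum_distrib_right)
  also have "\<dots> \<le> 1 + s * \<mu> + s^2 * (1 + 11 * B^2 * (1 + 1))"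
    using assms by (intro add_mono mult_left_mono) auto
  also have "\<dots> \<le> 1 + s * \<mu> + s^2 * (23 * B^2)"
    using sB one_le_power[of B 2] by (intro add_left_mono mult_left_mono) auto
  also have "\<dots> = 1 + s * (\<mu> + 23 * s * B^2)" by (simp add: algebra_simps power2_eq_square)
  also have "\<dots> \<le> exp (s * (\<mu> + 23 * s * B^2))" using exp_ge_add_one_self by blast
  finally show ?thesis .
qed

section \<open>Tilted measures\<close>

text \<open>The Chernoff (Hellinger) integral: the Renyi divergence of order \<alpha> is
  \<open>ln (affinity S w q \<alpha>) / (\<alpha> - 1)\<close>. For \<open>\<alpha> < 1\<close>, the
  inequality \<open>exp (- ((1 - \<alpha>) * \<gamma>)) \<le> affinity S w q \<alpha>\<close> thus
  says that this divergence is at most \<gamma>.\<close>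

definition affinity :: "'y set \<Rightarrow> ('y \<Rightarrow> real) \<Rightarrow> ('y \<Rightarrow> real) \<Rightarrow> real \<Rightarrow> real" where
  "affinity S w q \<alpha> = (\<Sum>y\<in>S. w y powr \<alpha> * q y powr (1 - \<alpha>))"

definition tilted :: "'y set \<Rightarrow> ('y \<Rightarrow> real) \<Rightarrow> ('y \<Rightarrow> real) \<Rightarrow> real \<Rightarrow> 'y \<Rightarrow> real" where
  "tilted S w q \<alpha> y = w y powr \<alpha> * q y powr (1 - \<alpha>) / affinity S w q \<alpha>"

text \<open>Outside the common support one factor is 0, whatever its exponent. Passing to that
  support makes all log-likelihood ratios finite.\<close>

lemma affinity_restrict_support:
  assumes "finite S" "\<And>y. y \<in> S \<Longrightarrow> 0 \<le> w y" "\<And>y. y \<in> S \<Longrightarrow> 0 \<le> q y"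
  shows "affinity {y \<in> S. 0 < w y \<and> 0 < q y} w q \<alpha> = affinity S w q \<alpha>"
  unfolding affinity_def
  using assms by (intro sum.mono_neutral_left) (auto simp: less_le)

text \<open>Monotonicity of the Renyi divergence in its order. The affinity is a
  \<open>w\<close>-mean of powers of \<open>q / w\<close>, and Jensen's inequality with exponent
  \<open>(1 - \<alpha>) / (1 - \<beta>)\<close> compares two of them. It carries a bound from a grid
  order down to an arbitrary smaller order.\<close>

lemma affinity_log_mono:
  assumes S: "finite S" "\<And>y. y \<in> S \<Longrightarrow> 0 < w y" "\<And>y. y \<in> S \<Longrightarrow> 0 < q y" "sum w S \<le> 1"
    and ab: "\<alpha> \<le> \<beta>" "\<beta> < 1" and bd: "exp (- ((1 - \<beta>) * \<gamma>)) \<le> affinity S w q \<beta>"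
  shows "exp (- ((1 - \<alpha>) * \<gamma>)) \<le> affinity S w q \<alpha>"
proof -
  define p where "p = (1 - \<alpha>) / (1 - \<beta>)"
  have p: "1 \<le> p" using ab by (simp add: p_def)
  have eq: "affinity S w q \<delta> = (\<Sum>y\<in>S. w y * (q y / w y) powr (1 - \<delta>))" for \<delta>
    unfolding affinity_def
  proof (rule sum.cong)
    fix y assume "y \<in> S"
    then have "0 < w y" using S by auto
    then show "w y powr \<delta> * q y powr (1 - \<delta>) = w y * (q y / w y) powr (1 - \<delta>)"
      by (simp add: powr_divide powr_diff field_simps)
  qed auto
  have "exp (- ((1 - \<alpha>) * \<gamma>)) = exp (- ((1 - \<beta>) * \<gamma>)) powr p"
    using ab by (simp add: powr_def p_def)
  also have "\<dots> \<le> affinity S w q \<beta> powr p" using bd p by (intro powr_mono2) auto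
  also have "\<dots> \<le> (\<Sum>y\<in>S. w y * ((q y / w y) powr (1 - \<beta>)) powr p)"
    unfolding eq using S p by (intro sum_powr_Jensen) (auto simp: less_imp_le)
  also have "\<dots> = affinity S w q \<alpha>"
    unfolding eq powr_powr using ab by (simp add: p_def)
  finally show ?thesis .
qed

lemma neg_log_ratio_moment:
  fixes V q :: "'y \<Rightarrow> real"
  assumes "finite S" "\<And>y. y \<in> S \<Longrightarrow> 0 < V y" "\<And>y. y \<in> S \<Longrightarrow> 0 < q y" "sum q S \<le> 1"
  shows "(\<Sum>y\<in>S. V y * exp (- ln (V y / q y))) \<le> 1"
proof -
  have "(\<Sum>y\<in>S. V y * exp (- ln (V y / q y))) = sum q S"
    using assms by (intro sum.cong) (auto simp: exp_minus less_imp_neq[symmetric])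
  then show ?thesis using assms by simp
qed

lemma relative_entropy_nonneg:
  fixes V q :: "'y \<Rightarrow> real"
  assumes "finite S" "\<And>y. y \<in> S \<Longrightarrow> 0 < V y" "\<And>y. y \<in> S \<Longrightarrow> 0 < q y" "sum q S \<le> 1" "sum V S = 1"
  shows "0 \<le> (\<Sum>y\<in>S. V y * ln (V y / q y))"
proof -
  have "1 - (\<Sum>y\<in>S. V y * ln (V y / q y)) = (\<Sum>y\<in>S. V y * (1 + - ln (V y / q y)))"
    using assms by (simp add: right_diff_distrib sum_subtractf)
  also have "\<dots> \<le> (\<Sum>y\<in>S. V y * exp (- ln (V y / q y)))"
    using assms by (intro sum_mono mult_left_mono exp_ge_add_one_self) (auto simp: less_imp_le)
  finally show ?thesis using neg_log_ratio_moment[of S V q] assms by simp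
qed

section \<open>Exponential tilting between two positive measures\<close>

context
  fixes S :: "'y set" and w q :: "'y \<Rightarrow> real"
  assumes S: "finite S" "S \<noteq> {}" and pos: "\<And>y. y \<in> S \<Longrightarrow> 0 < w y" "\<And>y. y \<in> S \<Longrightarrow> 0 < q y"
    and sub: "sum w S \<le> 1" "sum q S \<le> 1"
begin

lemma affinity_pos: "0 < affinity S w q \<alpha>"
  unfolding affinity_def using S pos
  by (intro sum_pos) (auto intro!: mult_pos_pos simp: less_imp_neq[symmetric] dest!: pos)

lemma tilted_pos: "y \<in> S \<Longrightarrow> 0 < tilted S w q \<alpha> y"
  unfolding tilted_def using affinity_pos pos[of y]
  by (intro divide_pos_pos mult_pos_pos) auto

lemma tilted_sum: "sum (tilted S w q \<alpha>) S = 1"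
  unfolding tilted_def sum_divide_distrib[symmetric] using affinity_pos[of \<alpha>] by (simp add: affinity_def)

lemma tilted_log_ratio:
  assumes "y \<in> S"
  shows "ln (tilted S w q \<alpha> y / q y) = \<alpha> * ln (w y / q y) - ln (affinity S w q \<alpha>)"
    and "ln (tilted S w q \<alpha> y / w y) = (\<alpha> - 1) * ln (w y / q y) - ln (affinity S w q \<alpha>)"
  using affinity_pos[of \<alpha>] pos[OF assms]
  by (simp_all add: tilted_def ln_div ln_mult ln_powr algebra_simps)

text \<open>In this combination the terms in \<open>ln (w y / q y)\<close> cancel. As the result
  does not depend on \<open>y\<close>, one ratio can be large only where the other is very negative;
  this is the coupling behind the moment bounds.\<close>

lemma tilted_log_ratio_convex:
  assumes "y \<in> S"
  shows "\<alpha> * ln (tilted S w q \<alpha> y / w y) + (1 - \<alpha>) * ln (tilted S w q \<alpha> y / q y) = - ln (affinity S w q \<alpha>)"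
  unfolding tilted_log_ratio[OF assms] by (simp add: algebra_simps)

lemma tilted_entropy_convex:
  "\<alpha> * (\<Sum>y\<in>S. tilted S w q \<alpha> y * ln (tilted S w q \<alpha> y / w y)) +
    (1 - \<alpha>) * (\<Sum>y\<in>S. tilted S w q \<alpha> y * ln (tilted S w q \<alpha> y / q y)) = - ln (affinity S w q \<alpha>)"
proof -
  have "\<alpha> * (\<Sum>y\<in>S. tilted S w q \<alpha> y * ln (tilted S w q \<alpha> y / w y)) +
    (1 - \<alpha>) * (\<Sum>y\<in>S. tilted S w q \<alpha> y * ln (tilted S w q \<alpha> y / q y)) =
    (\<Sum>y\<in>S. tilted S w q \<alpha> y * (\<alpha> * ln (tilted S w q \<alpha> y / w y) + (1 - \<alpha>) * ln (tilted S w q \<alpha> y / q y)))"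
    by (simp add: sum_distrib_left sum.distrib distrib_left ac_simps)
  also have "\<dots> = (\<Sum>y\<in>S. tilted S w q \<alpha> y * - ln (affinity S w q \<alpha>))"
    by (intro sum.cong) (simp_all add: tilted_log_ratio_convex)
  also have "\<dots> = - ln (affinity S w q \<alpha>)"
    unfolding sum_distrib_right[symmetric] by (simp add: tilted_sum)
  finally show ?thesis .
qed

text \<open>This makes the intermediate value theorem available for tuning the relative entropy to a
  prescribed rate.\<close>

lemma continuous_on_tilted_entropy:
  "continuous_on A (\<lambda>\<alpha>. \<Sum>y\<in>S. tilted S w q \<alpha> y * ln (tilted S w q \<alpha> y / q y))"
proof -
  have aff: "continuous_on A (affinity S w q)"
    unfolding affinity_def using pos by (intro continuous_intros) (auto dest: pos)
  have "continuous_on A (\<lambda>\<alpha>. \<Sum>y\<in>S. tilted S w q \<alpha> y * (\<alpha> * ln (w y / q y) - ln (affinity S w q \<alpha>)))"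
    unfolding tilted_def using aff affinity_pos pos
    by (intro continuous_intros) (auto simp: less_imp_neq[symmetric] dest!: pos)
  then show ?thesis by (simp add: tilted_log_ratio cong: sum.cong)
qed

text \<open>Both bounds are \<open>exp_moment_coupled_tails\<close> with the two ratios exchanged.
  The constant convex combination is divided by the coefficient of the ratio in question, and
  \<open>min \<alpha> (1 - \<alpha>)\<close> covers both coefficients at once.\<close>

lemma tilted_moments:
  assumes \<alpha>: "0 < \<alpha>" "\<alpha> < 1" and B: "- ln (affinity S w q \<alpha>) + 1 \<le> B * min \<alpha> (1 - \<alpha>)"
    and s: "0 < s" "s * B \<le> 1/2"
    and mean_q: "(\<Sum>y\<in>S. tilted S w q \<alpha> y * ln (tilted S w q \<alpha> y / q y)) \<le> \<mu>"
    and mean_w: "(\<Sum>y\<in>S. tilted S w q \<alpha> y * ln (tilted S w q \<alpha> y / w y)) \<le> \<nu>"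
  shows "(\<Sum>y\<in>S. tilted S w q \<alpha> y * exp (s * ln (tilted S w q \<alpha> y / q y))) \<le> exp (s * (\<mu> + 23 * s * B^2))"
    and "(\<Sum>y\<in>S. tilted S w q \<alpha> y * exp (s * ln (tilted S w q \<alpha> y / w y))) \<le> exp (s * (\<nu> + 23 * s * B^2))"
proof -
  let ?V = "tilted S w q \<alpha>"
  define \<phi> where "\<phi> = - ln (affinity S w q \<alpha>)"
  have ent: "0 \<le> (\<Sum>y\<in>S. ?V y * ln (?V y / q y))" "0 \<le> (\<Sum>y\<in>S. ?V y * ln (?V y / w y))"
    using S pos sub tilted_pos tilted_sum by (intro relative_entropy_nonneg; auto)+
  have \<phi>: "0 \<le> \<phi>"
    unfolding \<phi>_def tilted_entropy_convex[symmetric] using ent \<alpha> by auto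
  have B1: "1 \<le> B"
  proof -
    have "1 \<le> B * min \<alpha> (1 - \<alpha>)" using B \<phi> by (simp add: \<phi>_def)
    moreover have "0 < min \<alpha> (1 - \<alpha>)" using \<alpha> by auto
    ultimately have "0 < B" by (smt (verit) zero_less_mult_pos2)
    then have "B * min \<alpha> (1 - \<alpha>) \<le> B * 1" using \<alpha> by (intro mult_left_mono) auto
    then show ?thesis using \<open>1 \<le> B * min \<alpha> (1 - \<alpha>)\<close> by simp
  qed
  \<comment> \<open>Here \<open>c\<close> is the coefficient of the ratio to be bounded:
    \<open>1 - \<alpha>\<close> for the ratio to \<open>q\<close>, \<alpha> for the ratio to
    \<open>w\<close>.\<close>
  have key: "u \<le> B * (1 + max 0 (- v))" if "c * u + (1 - c) * v = \<phi>" "0 < c" "c < 1" "min \<alpha> (1 - \<alpha>) \<le> c" for u v c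
  proof -
    have "c * u = \<phi> + (1 - c) * (- v)" using that by (simp add: algebra_simps)
    also have "(1 - c) * (- v) \<le> (1 - c) * max 0 (- v)" using that by (intro mult_left_mono) auto
    also have "\<dots> \<le> 1 * max 0 (- v)" using that by (intro mult_right_mono) auto
    also have "\<phi> + 1 * max 0 (- v) \<le> (\<phi> + 1) * (1 + max 0 (- v))"
      using \<phi> by (simp add: algebra_simps max_def)
    also have "\<dots> \<le> (B * c) * (1 + max 0 (- v))"
    proof (rule mult_right_mono)
      have "\<phi> + 1 \<le> B * min \<alpha> (1 - \<alpha>)" using B by (simp add: \<phi>_def)
      also have "\<dots> \<le> B * c" using B1 that by (intro mult_left_mono) auto
      finally show "\<phi> + 1 \<le> B * c" .
    qed auto
    finally have "c * u \<le> c * (B * (1 + max 0 (- v)))" by (simp add: ac_simps)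
    then show ?thesis using that by simp
  qed
  have neg: "(\<Sum>y\<in>S. ?V y * exp (- ln (?V y / q y))) \<le> 1" "(\<Sum>y\<in>S. ?V y * exp (- ln (?V y / w y))) \<le> 1"
    using S pos sub tilted_pos by (intro neg_log_ratio_moment; auto)+
  show "(\<Sum>y\<in>S. ?V y * exp (s * ln (?V y / q y))) \<le> exp (s * (\<mu> + 23 * s * B^2))"
  proof (rule exp_moment_coupled_tails[OF S(1) _ tilted_sum neg s(1) B1 s(2) _ mean_q])
    fix y assume "y \<in> S"
    then show "ln (?V y / q y) \<le> B * (1 + max 0 (- ln (?V y / w y)))"
      using \<alpha> tilted_log_ratio_convex[of y \<alpha>] by (intro key[of "1 - \<alpha>"]) (auto simp: \<phi>_def)
  qed (use tilted_pos in \<open>auto simp: less_imp_le\<close>)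
  show "(\<Sum>y\<in>S. ?V y * exp (s * ln (?V y / w y))) \<le> exp (s * (\<nu> + 23 * s * B^2))"
  proof (rule exp_moment_coupled_tails[OF S(1) _ tilted_sum neg(2,1) s(1) B1 s(2) _ mean_w])
    fix y assume "y \<in> S"
    then show "ln (?V y / w y) \<le> B * (1 + max 0 (- ln (?V y / q y)))"
      using \<alpha> tilted_log_ratio_convex[of y \<alpha>] by (intro key[of \<alpha>]) (auto simp: \<phi>_def)
  qed (use tilted_pos in \<open>auto simp: less_imp_le\<close>)
qed

end

text \<open>For measures of mass one and \<open>s > 0\<close> this says that the Renyi divergence of
  order \<open>1 + s\<close> is at most \<open>a\<close>. Absolute continuity is a separate clause
  because division by zero yields 0 and would hide an infinite ratio.\<close>

definition moment_dominated :: "'y set \<Rightarrow> real \<Rightarrow> ('y \<Rightarrow> real) \<Rightarrow> ('y \<Rightarrow> real) \<Rightarrow> real \<Rightarrow> bool" where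
  "moment_dominated \<Omega> s V Q a \<longleftrightarrow> (\<forall>y\<in>\<Omega>. 0 < V y \<longrightarrow> 0 < Q y) \<and>
     (\<Sum>y\<in>\<Omega>. V y * (V y / Q y) powr s) \<le> exp (s * a)"

lemma moment_dominated_mono:
  "moment_dominated \<Omega> s V Q a \<Longrightarrow> a \<le> b \<Longrightarrow> 0 \<le> s \<Longrightarrow> moment_dominated \<Omega> s V Q b"
  unfolding moment_dominated_def by (smt (verit) exp_le_cancel_iff mult_left_mono)

text \<open>Points with \<open>V y \<le> exp (a + t) * Q y\<close> are charged to \<open>Q\<close>;
  at the others the likelihood ratio exceeds \<open>exp (a + t)\<close>, and Markov's inequality for
  its power \<open>s\<close> leaves mass \<open>exp (- s * t)\<close>.\<close>

lemma moment_dominated_Markov: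
  assumes "moment_dominated \<Omega> s V Q a" "finite \<Omega>" "\<And>y. y \<in> \<Omega> \<Longrightarrow> 0 \<le> V y" "\<And>y. y \<in> \<Omega> \<Longrightarrow> 0 \<le> Q y"
    and "T \<subseteq> \<Omega>" "0 < s"
  shows "sum V T \<le> exp (- s * t) + exp (a + t) * sum Q T"
proof -
  have "V y \<le> V y * (V y / Q y) powr s * exp (- s * (a + t)) + exp (a + t) * Q y" if y: "y \<in> \<Omega>" for y
  proof (cases "V y \<le> exp (a + t) * Q y")
    case True
    then show ?thesis using assms(3)[OF y] by (simp add: add_increasing)
  next
    case False
    then have V: "0 < V y" using assms(4)[OF y] by (smt (verit) exp_gt_zero mult_nonneg_nonneg)
    then have Q: "0 < Q y" using assms(1) y by (auto simp: moment_dominated_def)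
    have "exp (a + t) \<le> V y / Q y" using False Q by (simp add: field_simps)
    then have "exp (a + t) powr s \<le> (V y / Q y) powr s" using \<open>0 < s\<close> by (intro powr_mono2) auto
    then have "exp (s * (a + t)) * exp (- s * (a + t)) \<le> (V y / Q y) powr s * exp (- s * (a + t))"
      by (intro mult_right_mono) (auto simp: powr_def)
    then have "1 \<le> (V y / Q y) powr s * exp (- s * (a + t))" by (simp flip: exp_add)
    then have "V y * 1 \<le> V y * ((V y / Q y) powr s * exp (- s * (a + t)))"
      using V by (intro mult_left_mono) auto
    moreover have "0 \<le> exp (a + t) * Q y" using Q by simp
    ultimately show ?thesis by (simp add: mult.assoc)
  qed
  then have "sum V T \<le> (\<Sum>y\<in>T. V y * (V y / Q y) powr s * exp (- s * (a + t)) + exp (a + t) * Q y)"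
    using assms(5) by (intro sum_mono) auto
  also have "\<dots> = (\<Sum>y\<in>T. V y * (V y / Q y) powr s) * exp (- s * (a + t)) + exp (a + t) * sum Q T"
    by (simp add: sum.distrib sum_distrib_left sum_distrib_right)
  also have "(\<Sum>y\<in>T. V y * (V y / Q y) powr s) \<le> (\<Sum>y\<in>\<Omega>. V y * (V y / Q y) powr s)"
    using assms by (intro sum_mono2) auto
  also have "\<dots> \<le> exp (s * a)" using assms by (simp add: moment_dominated_def)
  finally show ?thesis by (simp add: algebra_simps flip: exp_add)
qed

lemma moment_dominated_subset:
  assumes "finite \<Omega>" "S \<subseteq> \<Omega>" "\<And>y. y \<in> S \<Longrightarrow> 0 < V y" "\<And>y. y \<in> S \<Longrightarrow> 0 < Q y"
    and "(\<Sum>y\<in>S. V y * exp (s * ln (V y / Q y))) \<le> exp (s * a)"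
  shows "moment_dominated \<Omega> s (\<lambda>y. if y \<in> S then V y else 0) Q a"
proof -
  have "(\<Sum>y\<in>\<Omega>. (if y \<in> S then V y else 0) * ((if y \<in> S then V y else 0) / Q y) powr s)
      = (\<Sum>y\<in>S. V y * exp (s * ln (V y / Q y)))"
    using assms by (intro sum.mono_neutral_cong_right) (auto simp: powr_def dest!: assms(3,4))
  then show ?thesis using assms by (auto simp: moment_dominated_def)
qed

text \<open>The order \<open>\<alpha>\<close> of the tilted measure is chosen so that its relative entropy to \<open>q\<close> equals
  \<open>\<rho>\<close>; if even \<open>\<alpha> = 1 - \<eta>\<close> stays below \<open>\<rho>\<close> then that order is used, and the relative entropy to
  \<open>w\<close> is at most of order \<open>\<eta>\<close>. Staying away from \<open>\<alpha> = 1\<close> keeps the log-likelihood ratios tame.\<close>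

lemma exists_moment_dominated:
  fixes w q :: "'y \<Rightarrow> real" and \<Gamma> :: "real \<Rightarrow> real"
  assumes \<Omega>: "finite \<Omega>" "is_dist \<Omega> w" "is_dist \<Omega> q"
    and A: "\<alpha>0 \<in> A" "A \<subseteq> {\<alpha>0..<1}"
    and aff: "\<And>a. a \<in> A \<Longrightarrow> exp (- ((1 - a) * \<Gamma> a)) \<le> affinity \<Omega> w q a"
    and mesh: "\<And>\<alpha>. \<alpha>0 \<le> \<alpha> \<Longrightarrow> \<alpha> \<le> 1 - \<eta> \<Longrightarrow> \<exists>a\<in>A. \<alpha> \<le> a \<and> a \<le> \<alpha> + \<delta>"
    and \<alpha>0: "0 < \<alpha>0" and \<eta>: "0 < \<eta>" "\<alpha>0 \<le> 1 - \<eta>" and \<delta>: "0 \<le> \<delta>"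
    and \<Gamma>: "\<And>a. a \<in> A \<Longrightarrow> \<Gamma> a \<le> \<Gamma>max" "0 \<le> \<Gamma>max" "\<Gamma> \<alpha>0 \<le> \<rho>" "0 \<le> \<rho>"
    and d: "\<And>a. a \<in> A \<Longrightarrow> (1 - a) / a * (\<Gamma> a - \<rho>) + \<delta> / \<alpha>0^2 * \<Gamma>max \<le> d" "\<eta> / \<alpha>0 * \<Gamma>max \<le> d"
    and B: "(\<Gamma>max + 1 / \<eta>) / \<alpha>0 \<le> B" and s: "0 < s" "s * B \<le> 1 / 2"
  shows "\<exists>V. is_dist \<Omega> V \<and> moment_dominated \<Omega> s V q (\<rho> + 23 * s * B^2)
    \<and> moment_dominated \<Omega> s V w (d + 23 * s * B^2)"
proof -
  define S where "S = {y \<in> \<Omega>. 0 < w y \<and> 0 < q y}"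
  have nn: "\<And>y. y \<in> \<Omega> \<Longrightarrow> 0 \<le> w y" "\<And>y. y \<in> \<Omega> \<Longrightarrow> 0 \<le> q y" "sum w \<Omega> = 1" "sum q \<Omega> = 1"
    using \<Omega> by (auto simp: is_dist_def)
  have affS: "affinity S w q \<alpha> = affinity \<Omega> w q \<alpha>" for \<alpha>
    unfolding S_def using \<Omega> nn by (intro affinity_restrict_support) auto
  have S1: "finite S" "S \<subseteq> \<Omega>" "\<And>y. y \<in> S \<Longrightarrow> 0 < w y" "\<And>y. y \<in> S \<Longrightarrow> 0 < q y"
    using \<Omega> by (auto simp: S_def)
  have S2: "sum w S \<le> 1" "sum q S \<le> 1"
    using sum_mono2[OF \<Omega>(1) S1(2), of w] sum_mono2[OF \<Omega>(1) S1(2), of q] nn by auto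
  have S3: "S \<noteq> {}"
  proof
    assume "S = {}"
    then have "affinity \<Omega> w q \<alpha>0 = 0" using affS[of \<alpha>0] by (simp add: affinity_def)
    then show False using aff[OF A(1)] by (simp add: not_le)
  qed
  note S = S1(1) S3 S1(3,4) S2
  have \<alpha>01: "\<alpha>0 < 1" using A by auto
  define V where "V \<alpha> = tilted S w q \<alpha>" for \<alpha>
  define Dq where "Dq \<alpha> = (\<Sum>y\<in>S. V \<alpha> y * ln (V \<alpha> y / q y))" for \<alpha>
  define Dw where "Dw \<alpha> = (\<Sum>y\<in>S. V \<alpha> y * ln (V \<alpha> y / w y))" for \<alpha>
  have D0: "0 \<le> Dq \<alpha>" "0 \<le> Dw \<alpha>" for \<alpha>
    unfolding Dq_def Dw_def V_def using S tilted_pos[OF S] tilted_sum[OF S]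
    by (intro relative_entropy_nonneg; auto)+
  have conv: "\<alpha> * Dw \<alpha> + (1 - \<alpha>) * Dq \<alpha> = - ln (affinity S w q \<alpha>)" for \<alpha>
    unfolding Dq_def Dw_def V_def by (rule tilted_entropy_convex[OF S])
  have \<phi>: "- ln (affinity S w q \<alpha>) \<le> (1 - \<alpha>) * \<Gamma> a" if "a \<in> A" "\<alpha> \<le> a" for \<alpha> a
  proof -
    have "exp (- ((1 - \<alpha>) * \<Gamma> a)) \<le> affinity S w q \<alpha>"
      using S aff[OF that(1)] A that by (intro affinity_log_mono[of S w q \<alpha> a]) (auto simp: affS)
    then have "- ((1 - \<alpha>) * \<Gamma> a) \<le> ln (affinity S w q \<alpha>)"
      using affinity_pos[OF S, of \<alpha>] by (simp add: ln_ge_iff)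
    then show ?thesis by linarith
  qed
  \<comment> \<open>At the left end of the range of orders, nonnegativity of \<open>Dw\<close>
    already keeps \<open>Dq\<close> below \<rho>; this is the starting value for the intermediate
    value theorem.\<close>
  have "\<alpha>0 * Dw \<alpha>0 + (1 - \<alpha>0) * Dq \<alpha>0 \<le> (1 - \<alpha>0) * \<rho>"
    unfolding conv
    using order_trans[OF \<phi>[OF A(1) order_refl] mult_left_mono[OF \<Gamma>(3), of "1 - \<alpha>0"]] \<alpha>01 by auto
  moreover have "0 \<le> \<alpha>0 * Dw \<alpha>0" using \<alpha>0 D0 by simp
  ultimately have "(1 - \<alpha>0) * Dq \<alpha>0 \<le> (1 - \<alpha>0) * \<rho>" by linarith
  then have Dq0: "Dq \<alpha>0 \<le> \<rho>" using \<alpha>01 by simp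
  have "\<exists>\<alpha>. \<alpha>0 \<le> \<alpha> \<and> \<alpha> \<le> 1 - \<eta> \<and> Dq \<alpha> \<le> \<rho> \<and> (Dq \<alpha> = \<rho> \<or> \<alpha> = 1 - \<eta>)"
  proof (cases "Dq (1 - \<eta>) \<le> \<rho>")
    case False
    have "continuous_on {\<alpha>0..1-\<eta>} Dq"
      unfolding Dq_def V_def by (rule continuous_on_tilted_entropy[OF S])
    then obtain \<alpha> where "\<alpha>0 \<le> \<alpha>" "\<alpha> \<le> 1 - \<eta>" "Dq \<alpha> = \<rho>"
      using IVT'[of Dq \<alpha>0 \<rho> "1 - \<eta>"] Dq0 False \<eta> by auto
    then show ?thesis by auto
  qed (use \<eta> in auto)
  then obtain \<alpha> where \<alpha>: "\<alpha>0 \<le> \<alpha>" "\<alpha> \<le> 1 - \<eta>" "Dq \<alpha> \<le> \<rho>" "Dq \<alpha> = \<rho> \<or> \<alpha> = 1 - \<eta>" by blast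
  obtain a where a: "a \<in> A" "\<alpha> \<le> a" "a \<le> \<alpha> + \<delta>" using mesh \<alpha> by blast
  have \<alpha>': "0 < \<alpha>" "\<alpha> < 1" "0 < a" using \<alpha> \<alpha>0 \<eta> a by auto
  have a1: "a < 1" using a A by auto
  have Dw: "Dw \<alpha> \<le> d"
  proof (cases "Dq \<alpha> = \<rho>")
    case True
    have "\<alpha> * Dw \<alpha> \<le> (1 - \<alpha>) * (\<Gamma> a - \<rho>)"
      using conv[of \<alpha>] \<phi>[OF a(1,2)] True by (simp add: algebra_simps)
    then have "Dw \<alpha> \<le> (1 - \<alpha>) / \<alpha> * (\<Gamma> a - \<rho>)" using \<alpha>' by (simp add: field_simps)
    \<comment> \<open>Since \<open>1 / \<alpha> - 1 / a = (a - \<alpha>) / (\<alpha> * a)\<close>,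
      moving to the grid order \<open>a\<close> costs at most
      \<open>\<delta> / \<alpha>0^2 * \<Gamma>max\<close>.\<close>
    also have "\<dots> = (1 - a) / a * (\<Gamma> a - \<rho>) + (a - \<alpha>) / (\<alpha> * a) * (\<Gamma> a - \<rho>)"
      using \<alpha>' by (simp add: field_simps)
    also have "(a - \<alpha>) / (\<alpha> * a) * (\<Gamma> a - \<rho>) \<le> (a - \<alpha>) / (\<alpha> * a) * \<Gamma>max"
      using \<alpha>' a \<Gamma>(1)[OF a(1)] \<Gamma>(4) by (intro mult_left_mono) auto
    also have "\<dots> \<le> \<delta> / \<alpha>0^2 * \<Gamma>max"
      unfolding power2_eq_square
      using \<alpha>' a \<Gamma>(2) \<alpha> \<alpha>0 by (intro mult_right_mono frac_le mult_mono) auto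
    finally show ?thesis using d(1)[OF a(1)] by linarith
  next
    case False
    then have \<alpha>\<eta>: "\<alpha> = 1 - \<eta>" using \<alpha> by auto
    have "\<alpha> * Dw \<alpha> \<le> (1 - \<alpha>) * \<Gamma> a"
      using conv[of \<alpha>] \<phi>[OF a(1,2)] mult_nonneg_nonneg[OF _ D0(1)[of \<alpha>], of "1 - \<alpha>"] \<alpha>' by simp
    also have "\<dots> \<le> \<eta> * \<Gamma>max" using \<Gamma>(1)[OF a(1)] \<alpha>\<eta> \<eta> by simp
    finally have "Dw \<alpha> \<le> \<eta> * \<Gamma>max / \<alpha>" using \<alpha>' by (simp add: field_simps)
    also have "\<dots> \<le> \<eta> * \<Gamma>max / \<alpha>0" using \<alpha> \<alpha>0 \<eta> \<Gamma>(2) by (intro divide_left_mono) auto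
    finally show ?thesis using d(2) by simp
  qed
  \<comment> \<open>The bound \<open>1 - \<alpha> \<ge> \<eta>\<close> turns the summand 1 into at
    most \<open>(1 - \<alpha>) / \<eta>\<close>, and \<open>\<alpha> \<ge> \<alpha>0\<close>
    accounts for the division by \<alpha>0 in the lower bound on \<open>B\<close>.\<close>
  have \<phi>B: "- ln (affinity S w q \<alpha>) + 1 \<le> B * min \<alpha> (1 - \<alpha>)"
  proof -
    let ?\<phi> = "- ln (affinity S w q \<alpha>)"
    have 1: "?\<phi> \<le> (1 - \<alpha>) * \<Gamma>max"
      using order_trans[OF \<phi>[OF a(1,2)] mult_left_mono[OF \<Gamma>(1)[OF a(1)], of "1 - \<alpha>"]] \<alpha>' by auto
    have \<alpha>0le: "c \<le> c / \<alpha>0" if "0 \<le> c" for c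
      using that \<alpha>0 \<alpha>01 by (simp add: pos_le_divide_eq mult_left_le)
    have B0: "(\<Gamma>max + 1/\<eta>) / \<alpha>0 * \<alpha> \<le> B * \<alpha>" "(\<Gamma>max + 1/\<eta>) / \<alpha>0 * (1 - \<alpha>) \<le> B * (1 - \<alpha>)"
      using B \<alpha>' by (intro mult_right_mono; auto)+
    have "?\<phi> + 1 \<le> (\<Gamma>max + 1/\<eta>) * (1 - \<alpha>)"
    proof -
      have "1 \<le> (1 - \<alpha>) / \<eta>" using \<alpha> \<eta> by simp
      then show ?thesis using 1 by (simp add: algebra_simps)
    qed
    moreover have "(\<Gamma>max + 1/\<eta>) * (1 - \<alpha>) \<le> (\<Gamma>max + 1/\<eta>) / \<alpha>0 * (1 - \<alpha>)"
      using \<alpha>' \<Gamma>(2) \<eta> by (intro mult_right_mono \<alpha>0le) auto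
    moreover have "?\<phi> + 1 \<le> \<Gamma>max + 1/\<eta>"
    proof -
      have "(1 - \<alpha>) * \<Gamma>max \<le> 1 * \<Gamma>max" using \<alpha>' \<Gamma> by (intro mult_right_mono) auto
      moreover have "1 \<le> 1/\<eta>" using \<eta> \<alpha>0 by simp
      ultimately show ?thesis using 1 by linarith
    qed
    moreover have "\<Gamma>max + 1/\<eta> \<le> (\<Gamma>max + 1/\<eta>) / \<alpha>0 * \<alpha>"
    proof -
      have "1 \<le> \<alpha> / \<alpha>0" using \<alpha> \<alpha>0 by simp
      then have "(\<Gamma>max + 1/\<eta>) * 1 \<le> (\<Gamma>max + 1/\<eta>) * (\<alpha> / \<alpha>0)" using \<Gamma>(2) \<eta> by (intro mult_left_mono) auto
      then show ?thesis by simp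
    qed
    ultimately show ?thesis using B0 by (auto simp: min_def)
  qed
  note mom = tilted_moments[OF S \<alpha>'(1,2) \<phi>B s \<alpha>(3)[unfolded Dq_def V_def] Dw[unfolded Dw_def V_def]]
  define U where "U = (\<lambda>y. if y \<in> S then V \<alpha> y else 0)"
  have "is_dist \<Omega> U"
  proof -
    have "sum U \<Omega> = sum (V \<alpha>) S"
      unfolding U_def using \<Omega> S1 by (simp add: sum.If_cases Int_absorb1)
    then show ?thesis using tilted_pos[OF S] tilted_sum[OF S] by (auto simp: is_dist_def U_def V_def less_imp_le)
  qed
  moreover have "moment_dominated \<Omega> s U q (\<rho> + 23 * s * B^2)" "moment_dominated \<Omega> s U w (d + 23 * s * B^2)"
    unfolding U_def V_def using \<Omega> S1 tilted_pos[OF S] mom by (intro moment_dominated_subset; auto)+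
  ultimately show ?thesis by blast
qed

section \<open>Renyi capacity and center\<close>

text \<open>This is \<open>exp (- E0)\<close> for Gallager's function \<open>E0\<close> with
  parameter \<open>(1 - \<alpha>) / \<alpha>\<close>. For orders below one, maximising the Renyi
  information means minimising this sum, which is convex in \<open>p\<close>.\<close>

definition renyi_sum :: "real \<Rightarrow> 'x set \<Rightarrow> 'y set \<Rightarrow> ('x \<Rightarrow> 'y \<Rightarrow> real) \<Rightarrow> ('x \<Rightarrow> real) \<Rightarrow> real" where
  "renyi_sum \<alpha> X Y W p = (\<Sum>y\<in>Y. (\<Sum>x\<in>X. p x * W x y powr \<alpha>) powr (1 / \<alpha>))"

lemma renyi_info_eq:
  assumes "0 < \<alpha>" "\<alpha> < 1"
  shows "renyi_info \<alpha> X Y W p = - (\<alpha> / (1 - \<alpha>) * ln (renyi_sum \<alpha> X Y W p))"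
  using assms unfolding renyi_info_def renyi_sum_def by (simp add: minus_divide_right)

text \<open>Distributions are total functions whose values off \<open>X\<close> are free; pinning
  these to 0 leaves a closed part of a product of compact sets, compact by Tychonoff.\<close>

lemma compact_dist_simplex:
  fixes X :: "'x set"
  assumes "finite X"
  shows "compact {p. is_dist X p \<and> (\<forall>x. x \<notin> X \<longrightarrow> p x = 0)}"
proof -
  have eq: "{p. is_dist X p \<and> (\<forall>x. x \<notin> X \<longrightarrow> p x = 0)} =
      (Pi\<^sub>E UNIV (\<lambda>x. if x \<in> X then {0..1::real} else {0})) \<inter> {p. sum p X = 1}"
    using member_le_sum[of _ X] assms
    by (fastforce simp: is_dist_def PiE_iff split: if_split_asm)
  have "compactin (product_topology (\<lambda>_. euclidean) UNIV) (Pi\<^sub>E UNIV (\<lambda>x. if x \<in> X then {0..1::real} else {0}))"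
    by (simp add: compactin_PiE)
  then have "compact (Pi\<^sub>E UNIV (\<lambda>x. if x \<in> X then {0..1::real} else {0}))"
    by (simp add: euclidean_product_topology)
  moreover have "closed {p::'x \<Rightarrow> real. sum p X = 1}"
    by (intro closed_Collect_eq continuous_on_sum continuous_on_const continuous_on_product_coordinates)
  ultimately show ?thesis unfolding eq by (rule compact_Int_closed)
qed

lemma channel_le_one:
  assumes "discrete_channel X Y W" "x \<in> X" "y \<in> Y"
  shows "W x y \<le> 1"
proof -
  have "W x y \<le> sum (W x) Y" using assms by (intro member_le_sum) (auto simp: discrete_channel_def)
  then show ?thesis using assms by (simp add: discrete_channel_def)
qed

text \<open>As channel values lie in [0,1], \<open>W x y \<le> W x y powr \<alpha>\<close>, so the
  inner sums total at least one; Jensen's inequality with uniform weights on \<open>Y\<close>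
  concludes. The bound gives positivity of the sum and a capacity bound uniform in the
  order.\<close>

lemma renyi_sum_ge:
  assumes W: "discrete_channel X Y W" and \<alpha>: "0 < \<alpha>" "\<alpha> < 1" and p: "is_dist X p"
  shows "real (card Y) powr (1 - 1 / \<alpha>) \<le> renyi_sum \<alpha> X Y W p"
proof -
  define N where "N = real (card Y)"
  define u where "u y = (\<Sum>x\<in>X. p x * W x y powr \<alpha>)" for y
  have Y: "finite Y" "0 < N" using W by (auto simp: discrete_channel_def N_def card_gt_0_iff)
  have u0: "0 \<le> u y" for y unfolding u_def using p by (intro sum_nonneg) (auto simp: is_dist_def)
  have "1 = (\<Sum>x\<in>X. p x * (\<Sum>y\<in>Y. W x y))"
    using W p by (simp add: discrete_channel_def is_dist_def)
  also have "\<dots> = (\<Sum>y\<in>Y. \<Sum>x\<in>X. p x * W x y)"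
    unfolding sum_distrib_left by (rule sum.swap)
  also have "\<dots> \<le> sum u Y"
    unfolding u_def
  proof (intro sum_mono mult_left_mono)
    fix x y assume xy: "x \<in> X" "y \<in> Y"
    then have "W x y \<le> 1" "0 \<le> W x y"
      using W channel_le_one[OF W xy] by (auto simp: discrete_channel_def)
    then show "W x y \<le> W x y powr \<alpha>"
      using \<alpha> powr_mono'[of \<alpha> 1 "W x y"] by (cases "W x y = 0") auto
  qed (use p in \<open>auto simp: is_dist_def\<close>)
  finally have "1 \<le> sum u Y" .
  then have "(1 / N) powr (1/\<alpha>) \<le> (\<Sum>y\<in>Y. 1 / N * u y) powr (1/\<alpha>)"
    using \<alpha> Y by (intro powr_mono2) (auto simp: divide_right_mono simp flip: sum_divide_distrib)
  also have "\<dots> \<le> (\<Sum>y\<in>Y. 1 / N * u y powr (1/\<alpha>))"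
    using \<alpha> Y u0 by (intro sum_powr_Jensen) (auto simp: N_def)
  finally have "N * (1 / N) powr (1/\<alpha>) \<le> renyi_sum \<alpha> X Y W p"
    using Y unfolding renyi_sum_def u_def[symmetric] by (simp add: field_simps flip: sum_divide_distrib)
  then show ?thesis using Y unfolding N_def[symmetric] by (simp add: powr_divide powr_diff)
qed

lemma renyi_sum_pos:
  assumes "discrete_channel X Y W" "0 < \<alpha>" "\<alpha> < 1" "is_dist X p"
  shows "0 < renyi_sum \<alpha> X Y W p"
proof -
  have "0 < real (card Y) powr (1 - 1 / \<alpha>)"
    using assms by (auto simp: discrete_channel_def)
  then show ?thesis using renyi_sum_ge[OF assms] by linarith
qed

text \<open>A continuous function attains its minimum on the compact simplex. Attainment also
  settles boundedness, so that the real \<open>Sup\<close> in \<open>renyi_capacity\<close> is a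
  genuine supremum.\<close>

lemma renyi_capacity_attained:
  assumes W: "discrete_channel X Y W" and \<alpha>: "0 < \<alpha>" "\<alpha> < 1"
  obtains p where "is_dist X p" "\<And>p'. is_dist X p' \<Longrightarrow> renyi_sum \<alpha> X Y W p \<le> renyi_sum \<alpha> X Y W p'"
    "renyi_capacity \<alpha> X Y W = - (\<alpha> / (1 - \<alpha>) * ln (renyi_sum \<alpha> X Y W p))"
proof -
  let ?P = "{p. is_dist X p \<and> (\<forall>x. x \<notin> X \<longrightarrow> p x = 0)}"
  let ?F = "renyi_sum \<alpha> X Y W"
  have X: "finite X" "X \<noteq> {}" using W by (auto simp: discrete_channel_def)
  then obtain x0 where x0: "x0 \<in> X" by auto
  have "(\<lambda>x. of_bool (x = x0)) \<in> ?P" using X x0 by (auto simp: is_dist_def of_bool_def)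
  then have ne: "?P \<noteq> {}" by blast
  have "continuous_on ?P ?F"
    unfolding renyi_sum_def using \<alpha>
    by (intro continuous_on_sum continuous_on_powr' continuous_on_mult continuous_on_const
        continuous_on_subset[OF continuous_on_product_coordinates])
      (auto intro!: sum_nonneg mult_nonneg_nonneg simp: is_dist_def)
  then obtain p where p: "p \<in> ?P" "\<And>p'. p' \<in> ?P \<Longrightarrow> ?F p \<le> ?F p'"
    using continuous_attains_inf[OF compact_dist_simplex[OF X(1)] ne, of ?F] by blast
  \<comment> \<open>Truncation off \<open>X\<close> does not change the sum, so minimality extends
    from the pinned simplex to all distributions.\<close>
  have min: "?F p \<le> ?F p'" if "is_dist X p'" for p'
  proof -
    define p'' where "p'' x = (if x \<in> X then p' x else 0)" for x
    have "is_dist X p''" using that by (simp add: is_dist_def p''_def)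
    then have "?F p \<le> ?F p''" by (intro p) (auto simp: p''_def)
    also have "?F p'' = ?F p'" by (simp add: renyi_sum_def p''_def)
    finally show ?thesis .
  qed
  have "renyi_capacity \<alpha> X Y W = renyi_info \<alpha> X Y W p"
    unfolding renyi_capacity_def
  proof (rule cSup_eq_maximum)
    fix i assume "i \<in> (\<lambda>p. renyi_info \<alpha> X Y W p) ` {p. is_dist X p}"
    then obtain p' where p': "is_dist X p'" "i = renyi_info \<alpha> X Y W p'" by auto
    have "ln (?F p) \<le> ln (?F p')"
      using min[OF p'(1)] renyi_sum_pos[OF W \<alpha>] p p' by auto
    then show "i \<le> renyi_info \<alpha> X Y W p"
      unfolding p' renyi_info_eq[OF \<alpha>] using \<alpha> by (simp add: divide_right_mono mult_left_mono)
  qed (use p in auto)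
  then show thesis using that[of p] p min \<alpha> by (auto simp: renyi_info_eq)
qed

lemma renyi_sum_capacity_le:
  assumes "discrete_channel X Y W" "0 < \<alpha>" "\<alpha> < 1" "is_dist X p"
  shows "exp (- ((1 - \<alpha>) / \<alpha> * renyi_capacity \<alpha> X Y W)) \<le> renyi_sum \<alpha> X Y W p"
proof -
  obtain p' where "is_dist X p'" "renyi_sum \<alpha> X Y W p' \<le> renyi_sum \<alpha> X Y W p"
    "renyi_capacity \<alpha> X Y W = - (\<alpha> / (1 - \<alpha>) * ln (renyi_sum \<alpha> X Y W p'))"
    using renyi_capacity_attained[OF assms(1-3)] assms(4) by metis
  then show ?thesis using assms renyi_sum_pos[OF assms(1-3), of p'] by simp
qed

lemma renyi_capacity_le_ln_card:
  assumes "discrete_channel X Y W" "0 < \<alpha>" "\<alpha> < 1"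
  shows "renyi_capacity \<alpha> X Y W \<le> ln (real (card Y))"
proof -
  have Y: "0 < card Y" using assms by (auto simp: discrete_channel_def card_gt_0_iff)
  obtain p where p: "is_dist X p" "renyi_capacity \<alpha> X Y W = - (\<alpha> / (1 - \<alpha>) * ln (renyi_sum \<alpha> X Y W p))"
    using renyi_capacity_attained[OF assms] by metis
  have "(1 - 1/\<alpha>) * ln (real (card Y)) \<le> ln (renyi_sum \<alpha> X Y W p)"
    using ln_mono[OF renyi_sum_ge[OF assms p(1)]] Y by (simp add: ln_powr)
  then have "\<alpha> / (1 - \<alpha>) * ((1 - 1/\<alpha>) * ln (real (card Y))) \<le> \<alpha> / (1 - \<alpha>) * ln (renyi_sum \<alpha> X Y W p)"
    using assms by (intro mult_left_mono) auto
  also have "\<alpha> / (1 - \<alpha>) * ((1 - 1/\<alpha>) * ln (real (card Y))) = - ln (real (card Y))"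
    using assms by (simp add: field_simps)
  finally show ?thesis using p by simp
qed

text \<open>First-order optimality: moving the minimiser \<open>p\<close> towards the point mass at \<open>x\<close> cannot decrease
  the convex function \<open>renyi_sum\<close>, and the tangent inequality of \<open>t powr (1/\<alpha>)\<close> at the
  moved point gives the derivative condition in the limit.\<close>

lemma renyi_minimiser_optimal:
  assumes W: "discrete_channel X Y W" and \<alpha>: "0 < \<alpha>" "\<alpha> < 1" and p: "is_dist X p"
    and min: "\<And>p'. is_dist X p' \<Longrightarrow> renyi_sum \<alpha> X Y W p \<le> renyi_sum \<alpha> X Y W p'" and x: "x \<in> X"
  defines "u \<equiv> \<lambda>y. \<Sum>x\<in>X. p x * W x y powr \<alpha>"
  shows "renyi_sum \<alpha> X Y W p \<le> (\<Sum>y\<in>Y. W x y powr \<alpha> * u y powr (1 / \<alpha> - 1))"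
proof -
  define r where "r = 1 / \<alpha>"
  have r: "1 < r" using \<alpha> by (simp add: r_def)
  have X: "finite X" using W by (auto simp: discrete_channel_def)
  define v where "v y = W x y powr \<alpha>" for y
  define z where "z \<epsilon> y = u y + \<epsilon> * (v y - u y)" for \<epsilon> y
  have u0: "0 \<le> u y" for y unfolding u_def using p by (intro sum_nonneg) (auto simp: is_dist_def)
  have v0: "0 \<le> v y" for y by (simp add: v_def)
  have z0: "0 \<le> z \<epsilon> y" if "0 \<le> \<epsilon>" "\<epsilon> \<le> 1" for \<epsilon> y
  proof -
    have "z \<epsilon> y = (1 - \<epsilon>) * u y + \<epsilon> * v y" by (simp add: z_def algebra_simps)
    then show ?thesis using that u0 v0 by simp
  qed
  have step: "0 \<le> (\<Sum>y\<in>Y. z \<epsilon> y powr (r - 1) * (v y - u y))" if \<epsilon>: "0 < \<epsilon>" "\<epsilon> \<le> 1" for \<epsilon>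
  proof -
    define p' where "p' i = (1 - \<epsilon>) * p i + \<epsilon> * of_bool (i = x)" for i
    have sx: "(\<Sum>i\<in>X. of_bool (i = x) * h i) = h x" for h :: "_ \<Rightarrow> real"
      using X x by (simp add: of_bool_def if_distrib[where f="\<lambda>c. c * _"] cong: if_cong)
    have "is_dist X p'"
      using p \<epsilon> sx[of "\<lambda>_. 1"] by (auto simp: is_dist_def p'_def sum.distrib simp flip: sum_distrib_left)
    then have "renyi_sum \<alpha> X Y W p \<le> renyi_sum \<alpha> X Y W p'" by (rule min)
    also have "renyi_sum \<alpha> X Y W p' = (\<Sum>y\<in>Y. z \<epsilon> y powr r)"
    proof -
      have "(\<Sum>i\<in>X. p' i * W i y powr \<alpha>) = z \<epsilon> y" for y
      proof -
        have "(\<Sum>i\<in>X. p' i * W i y powr \<alpha>) = (1 - \<epsilon>) * u y + \<epsilon> * (\<Sum>i\<in>X. of_bool (i = x) * W i y powr \<alpha>)"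
          by (simp add: p'_def u_def distrib_right sum.distrib sum_distrib_left mult.assoc)
        then show ?thesis unfolding sx by (simp add: z_def v_def algebra_simps)
      qed
      then show ?thesis by (simp add: renyi_sum_def r_def)
    qed
    finally have "0 \<le> (\<Sum>y\<in>Y. z \<epsilon> y powr r) - (\<Sum>y\<in>Y. u y powr r)"
      by (simp add: renyi_sum_def u_def r_def)
    also have "\<dots> \<le> (\<Sum>y\<in>Y. r * z \<epsilon> y powr (r - 1) * (z \<epsilon> y - u y))"
      unfolding sum_subtractf[symmetric]
    proof (rule sum_mono)
      fix y
      show "z \<epsilon> y powr r - u y powr r \<le> r * z \<epsilon> y powr (r - 1) * (z \<epsilon> y - u y)"
        using powr_tangent_le[of "u y" "z \<epsilon> y" r] u0 z0[of \<epsilon> y] \<epsilon> r by (simp add: algebra_simps)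
    qed
    also have "\<dots> = (r * \<epsilon>) * (\<Sum>y\<in>Y. z \<epsilon> y powr (r - 1) * (v y - u y))"
      by (simp add: z_def sum_distrib_left mult_ac)
    finally have "0 \<le> (r * \<epsilon>) * (\<Sum>y\<in>Y. z \<epsilon> y powr (r - 1) * (v y - u y))" .
    moreover have "0 < r * \<epsilon>" using \<epsilon> r by simp
    ultimately show ?thesis by (metis zero_le_mult_iff not_le)
  qed
  \<comment> \<open>The base may tend to 0, where continuity of the power rests on the exponent
    \<open>r - 1\<close> being positive and the base being nonnegative to the right of 0.\<close>
  have "((\<lambda>\<epsilon>. \<Sum>y\<in>Y. z \<epsilon> y powr (r - 1) * (v y - u y)) \<longlongrightarrow> (\<Sum>y\<in>Y. z 0 y powr (r - 1) * (v y - u y))) (at_right 0)"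
  proof (intro tendsto_sum tendsto_mult tendsto_const tendsto_powr')
    fix y
    show "((\<lambda>\<epsilon>. z \<epsilon> y) \<longlongrightarrow> z 0 y) (at_right 0)" unfolding z_def by (intro tendsto_intros)
    have "\<forall>\<^sub>F \<epsilon> in at_right 0. 0 \<le> z \<epsilon> y"
      unfolding eventually_at_right_field using z0 by (intro exI[of _ 1]) auto
    then show "z 0 y \<noteq> 0 \<or> 0 < r - 1 \<and> (\<forall>\<^sub>F \<epsilon> in at_right 0. 0 \<le> z \<epsilon> y)"
      using r by simp
  qed
  moreover have "\<forall>\<^sub>F \<epsilon> in at_right 0. 0 \<le> (\<Sum>y\<in>Y. z \<epsilon> y powr (r - 1) * (v y - u y))"
    unfolding eventually_at_right_field using step by (intro exI[of _ 1]) auto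
  ultimately have "0 \<le> (\<Sum>y\<in>Y. z 0 y powr (r - 1) * (v y - u y))"
    by (intro tendsto_lowerbound[where F = "at_right 0"]) auto
  also have "\<dots> = (\<Sum>y\<in>Y. v y * u y powr (r - 1)) - (\<Sum>y\<in>Y. u y powr r)"
  proof -
    have "u y powr (r - 1) * u y = u y powr r" for y
      using u0[of y] r by (cases "u y = 0") (auto simp: powr_diff)
    then show ?thesis by (simp add: z_def left_diff_distrib sum_subtractf mult.commute)
  qed
  finally show ?thesis by (simp add: renyi_sum_def u_def v_def r_def)
qed

text \<open>The center is \<open>u powr (1 / \<alpha>)\<close> normalised by the minimal Renyi sum
  \<open>f\<close>. The first-order condition bounds the affinity below by
  \<open>f / f powr (1 - \<alpha>) = f powr \<alpha>\<close>, which is the exponential of the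
  capacity on the left.\<close>

theorem renyi_center_exists:
  assumes W: "discrete_channel X Y W" and \<alpha>: "0 < \<alpha>" "\<alpha> < 1"
  shows "\<exists>q. is_dist Y q \<and> (\<forall>x\<in>X. exp (- ((1 - \<alpha>) * renyi_capacity \<alpha> X Y W)) \<le> affinity Y (W x) q \<alpha>)"
proof -
  obtain p where p: "is_dist X p" "\<And>p'. is_dist X p' \<Longrightarrow> renyi_sum \<alpha> X Y W p \<le> renyi_sum \<alpha> X Y W p'"
    "renyi_capacity \<alpha> X Y W = - (\<alpha> / (1 - \<alpha>) * ln (renyi_sum \<alpha> X Y W p))"
    using renyi_capacity_attained[OF W \<alpha>] by metis
  define f where "f = renyi_sum \<alpha> X Y W p"
  have f: "0 < f" unfolding f_def by (rule renyi_sum_pos[OF W \<alpha> p(1)])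
  define u where "u y = (\<Sum>x\<in>X. p x * W x y powr \<alpha>)" for y
  define q where "q y = u y powr (1/\<alpha>) / f" for y
  have "is_dist Y q"
    using f by (simp add: is_dist_def q_def flip: sum_divide_distrib)
      (simp add: f_def renyi_sum_def u_def)
  moreover have "exp (- ((1 - \<alpha>) * renyi_capacity \<alpha> X Y W)) \<le> affinity Y (W x) q \<alpha>" if "x \<in> X" for x
  proof -
    have "exp (- ((1 - \<alpha>) * renyi_capacity \<alpha> X Y W)) = f powr \<alpha>"
      using p(3) f \<alpha> by (simp add: f_def[symmetric] powr_def)
    also have "\<dots> = f / f powr (1 - \<alpha>)" using f by (simp add: powr_diff)
    also have "\<dots> \<le> (\<Sum>y\<in>Y. W x y powr \<alpha> * u y powr (1/\<alpha> - 1)) / f powr (1 - \<alpha>)"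
      unfolding f_def u_def using renyi_minimiser_optimal[OF W \<alpha> p(1,2) that]
      by (intro divide_right_mono) auto
    also have "\<dots> = affinity Y (W x) q \<alpha>"
      unfolding affinity_def q_def sum_divide_distrib
      using \<alpha> by (intro sum.cong) (auto simp: powr_divide powr_powr field_simps)
    finally show ?thesis .
  qed
  ultimately show ?thesis by blast
qed

section \<open>Product channels and feedback strategies\<close>

lemma prod_set_0 [simp]: "prod_set X t 0 = {[]}"
  by (auto simp: prod_set_def)

lemma append_in_prod_set:
  assumes "length a = m"
  shows "a @ b \<in> prod_set X t (m + k) \<longleftrightarrow> a \<in> prod_set X t m \<and> b \<in> prod_set X (t + m) k"
proof -
  have "(\<forall>i<m+k. (a @ b) ! i \<in> X (t + i)) \<longleftrightarrow> (\<forall>i<m. a ! i \<in> X (t + i)) \<and> (\<forall>i<k. b ! i \<in> X (t + m + i))"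
    (is "?l \<longleftrightarrow> ?r")
  proof
    assume l: ?l
    have "b ! i \<in> X (t + m + i)" if "i < k" for i
      using l[rule_format, of "m + i"] that assms by (simp add: nth_append add.assoc)
    moreover have "a ! i \<in> X (t + i)" if "i < m" for i
      using l[rule_format, of i] that assms by (simp add: nth_append)
    ultimately show ?r by blast
  next
    assume r: ?r
    show ?l
    proof (intro allI impI)
      fix i assume "i < m + k"
      then show "(a @ b) ! i \<in> X (t + i)"
        using r[THEN conjunct1, rule_format, of i] r[THEN conjunct2, rule_format, of "i - m"] assms
        by (cases "i < m") (auto simp: nth_append)
    qed
  qed
  then show ?thesis using assms by (auto simp: prod_set_def)
qed

lemma sum_prod_set_add:
  "(\<Sum>xs\<in>prod_set X t (m + k). h xs) = (\<Sum>a\<in>prod_set X t m. \<Sum>b\<in>prod_set X (t + m) k. h (a @ b))"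
proof -
  have "(\<Sum>a\<in>prod_set X t m. \<Sum>b\<in>prod_set X (t + m) k. h (a @ b)) =
     (\<Sum>(a, b)\<in>prod_set X t m \<times> prod_set X (t + m) k. h (a @ b))"
    by (rule sum.cartesian_product)
  also have "\<dots> = (\<Sum>xs\<in>prod_set X t (m + k). h xs)"
  proof (rule sum.reindex_bij_witness[where i = "\<lambda>xs. (take m xs, drop m xs)" and j = "\<lambda>(a, b). a @ b"])
    fix p assume "p \<in> prod_set X t m \<times> prod_set X (t + m) k"
    then obtain a b where "p = (a, b)" "a \<in> prod_set X t m" "b \<in> prod_set X (t + m) k" by auto
    moreover from this have "length a = m" by (simp add: prod_set_def)
    ultimately show "(case p of (a, b) \<Rightarrow> a @ b) \<in> prod_set X t (m + k)"
      "(take m (case p of (a, b) \<Rightarrow> a @ b), drop m (case p of (a, b) \<Rightarrow> a @ b)) = p"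
      by (simp_all add: append_in_prod_set)
  next
    fix xs assume xs: "xs \<in> prod_set X t (m + k)"
    then have "length (take m xs) = m" by (simp add: prod_set_def)
    then show "(take m xs, drop m xs) \<in> prod_set X t m \<times> prod_set X (t + m) k"
      using append_in_prod_set[of "take m xs" m "drop m xs" X t k] xs by simp
  qed auto
  finally show ?thesis by simp
qed

lemma sum_prod_set_1: "(\<Sum>xs\<in>prod_set X t 1. h xs) = (\<Sum>x\<in>X t. h [x])"
  by (rule sum.reindex_bij_witness[where i = "\<lambda>x. [x]" and j = hd])
    (auto simp: prod_set_def length_Suc_conv)

lemma sum_prod_set_Suc:
  "(\<Sum>xs\<in>prod_set X t (Suc n). h xs) = (\<Sum>a\<in>prod_set X t n. \<Sum>x\<in>X (t + n). h (a @ [x]))"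
  using sum_prod_set_add[of h X t n 1] by (simp add: sum_prod_set_1[unfolded One_nat_def])

lemma finite_prod_set:
  assumes "\<And>i. i < n \<Longrightarrow> finite (X (t + i))"
  shows "finite (prod_set X t n)"
proof -
  have "prod_set X t n \<subseteq> {xs. set xs \<subseteq> (\<Union>i<n. X (t + i)) \<and> length xs = n}"
    unfolding prod_set_def set_conv_nth by blast
  moreover have "finite (\<Union>i<n. X (t + i))" using assms by auto
  ultimately show ?thesis using finite_lists_length_eq finite_subset by blast
qed

lemma prod_set_nonempty:
  assumes "\<And>i. i < n \<Longrightarrow> X (t + i) \<noteq> {}"
  shows "prod_set X t n \<noteq> {}"
proof -
  have "map (\<lambda>i. SOME x. x \<in> X (t + i)) [0..<n] \<in> prod_set X t n"
    using assms by (auto simp: prod_set_def some_in_eq)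
  then show ?thesis by blast
qed

lemma sum_prod_set_prod:
  fixes h :: "nat \<Rightarrow> 'a \<Rightarrow> real"
  shows "(\<Sum>xs\<in>prod_set X t n. \<Prod>i<n. h i (xs ! i)) = (\<Prod>i<n. \<Sum>x\<in>X (t + i). h i x)"
proof (induction n)
  case (Suc n)
  have "(\<Sum>xs\<in>prod_set X t (Suc n). \<Prod>i<Suc n. h i (xs ! i)) =
    (\<Sum>a\<in>prod_set X t n. (\<Prod>i<n. h i (a ! i)) * (\<Sum>x\<in>X (t + n). h n x))"
    unfolding sum_prod_set_Suc sum_distrib_left
    by (intro sum.cong refl) (auto simp: prod_set_def nth_append)
  then show ?case by (simp add: Suc flip: sum_distrib_right)
qed simp

text \<open>Unlike in \<open>fb_kernel\<close>, the starting time \<open>t\<close> is free and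
  strategies are indexed from 0 relative to it. A strategy continued after a fixed past is then
  again a strategy of the same kind.\<close>

definition feedback_kernel :: "(nat \<Rightarrow> 'a \<Rightarrow> 'b \<Rightarrow> real) \<Rightarrow> nat \<Rightarrow> nat \<Rightarrow> (nat \<Rightarrow> 'b list \<Rightarrow> 'a) \<Rightarrow> 'b list \<Rightarrow> real" where
  "feedback_kernel W t n e ys = (\<Prod>i<n. W (t + i) (e i (take i ys)) (ys ! i))"

definition strategies :: "(nat \<Rightarrow> 'a set) \<Rightarrow> (nat \<Rightarrow> 'b set) \<Rightarrow> nat \<Rightarrow> nat \<Rightarrow> (nat \<Rightarrow> 'b list \<Rightarrow> 'a) set" where
  "strategies X Y t n = {e. \<forall>i<n. \<forall>ys\<in>prod_set Y t i. e i ys \<in> X (t + i)}"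

lemma fb_kernel_eq: "fb_kernel W n e = feedback_kernel W 1 n (\<lambda>i. e (i + 1))"
  by (simp add: fun_eq_iff fb_kernel_def feedback_kernel_def)

lemma fb_inputs_strategies: "e \<in> fb_inputs X Y n \<longleftrightarrow> (\<lambda>i. e (i + 1)) \<in> strategies X Y 1 n"
  by (simp add: fb_inputs_def strategies_def)

lemma feedback_kernel_append:
  assumes "length a = m"
  shows "feedback_kernel W t (m + k) e (a @ b) =
    feedback_kernel W t m e a * feedback_kernel W (t + m) k (\<lambda>i ys. e (m + i) (a @ ys)) b"
proof -
  have "(\<Prod>i<m+k. h i) = (\<Prod>i<m. h i) * (\<Prod>i<k. h (m + i))" for h :: "nat \<Rightarrow> real"
    by (induction k) (simp_all add: mult.assoc)
  then show ?thesis using assms by (simp add: feedback_kernel_def nth_append add.assoc)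
qed

lemma strategies_append:
  assumes "e \<in> strategies X Y t (m + k)"
  shows "e \<in> strategies X Y t m"
    and "a \<in> prod_set Y t m \<Longrightarrow> (\<lambda>i ys. e (m + i) (a @ ys)) \<in> strategies X Y (t + m) k"
proof -
  show "e \<in> strategies X Y t m" using assms by (simp add: strategies_def)
  assume a: "a \<in> prod_set Y t m"
  then have "length a = m" by (simp add: prod_set_def)
  then show "(\<lambda>i ys. e (m + i) (a @ ys)) \<in> strategies X Y (t + m) k"
    using assms a by (auto simp: strategies_def append_in_prod_set add.assoc)
qed

section \<open>Output distributions, capacities and centers along feedback strategies\<close>

context
  fixes X :: "nat \<Rightarrow> 'a set" and Y :: "nat \<Rightarrow> 'b set" and W :: "nat \<Rightarrow> 'a \<Rightarrow> 'b \<Rightarrow> real"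
  assumes channels: "\<forall>t\<ge>1. discrete_channel (X t) (Y t) (W t)"
begin

lemma finite_output_set: "1 \<le> t \<Longrightarrow> finite (prod_set Y t n)"
  using channels by (intro finite_prod_set) (simp add: discrete_channel_def)

lemma feedback_kernel_nonneg:
  assumes "1 \<le> t" "e \<in> strategies X Y t n" "ys \<in> prod_set Y t n"
  shows "0 \<le> feedback_kernel W t n e ys"
  unfolding feedback_kernel_def
proof (rule prod_nonneg, clarify)
  fix i assume i: "i < n"
  have "take i ys \<in> prod_set Y t i" using assms(3) i by (auto simp: prod_set_def)
  then have "e i (take i ys) \<in> X (t + i)" using assms(2) i by (simp add: strategies_def)
  moreover have "ys ! i \<in> Y (t + i)" using assms(3) i by (simp add: prod_set_def)
  moreover have "discrete_channel (X (t + i)) (Y (t + i)) (W (t + i))" using channels assms(1) by simp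
  ultimately show "0 \<le> W (t + i) (e i (take i ys)) (ys ! i)" by (simp add: discrete_channel_def)
qed

lemma feedback_kernel_Suc:
  assumes "length a = n"
  shows "feedback_kernel W t (Suc n) e (a @ [y]) = feedback_kernel W t n e a * W (t + n) (e n a) y"
  using assms by (simp add: feedback_kernel_def nth_append)

lemma feedback_kernel_dist:
  assumes "1 \<le> t" "e \<in> strategies X Y t n"
  shows "is_dist (prod_set Y t n) (feedback_kernel W t n e)"
proof -
  have "(\<Sum>ys\<in>prod_set Y t n. feedback_kernel W t n e ys) = 1"
    using assms(2)
  proof (induction n)
    case (Suc n)
    have e: "e \<in> strategies X Y t n" using Suc.prems by (simp add: strategies_def)
    have "(\<Sum>ys\<in>prod_set Y t (Suc n). feedback_kernel W t (Suc n) e ys) =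
      (\<Sum>a\<in>prod_set Y t n. feedback_kernel W t n e a * (\<Sum>y\<in>Y (t + n). W (t + n) (e n a) y))"
      unfolding sum_prod_set_Suc sum_distrib_left
      by (intro sum.cong refl feedback_kernel_Suc) (simp add: prod_set_def)
    also have "\<dots> = (\<Sum>a\<in>prod_set Y t n. feedback_kernel W t n e a)"
    proof (rule sum.cong[OF refl])
      fix a assume "a \<in> prod_set Y t n"
      then have "e n a \<in> X (t + n)" using Suc.prems by (simp add: strategies_def)
      moreover have "discrete_channel (X (t + n)) (Y (t + n)) (W (t + n))" using channels assms(1) by simp
      ultimately show "feedback_kernel W t n e a * (\<Sum>y\<in>Y (t + n). W (t + n) (e n a) y) = feedback_kernel W t n e a"
        by (simp add: discrete_channel_def)
    qed
    finally show ?case using Suc.IH e by simp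
  qed (simp add: feedback_kernel_def)
  then show ?thesis using feedback_kernel_nonneg[OF assms] by (simp add: is_dist_def)
qed

lemma product_channel:
  assumes "1 \<le> t"
  shows "discrete_channel (prod_set X t n) (prod_set Y t n) (prod_kernel W t n)"
proof -
  have ch: "discrete_channel (X (t + i)) (Y (t + i)) (W (t + i))" for i using channels assms by simp
  have "finite (prod_set X t n)" "finite (prod_set Y t n)" "prod_set X t n \<noteq> {}" "prod_set Y t n \<noteq> {}"
    using ch by (auto intro!: finite_prod_set prod_set_nonempty simp del: ex_in_conv simp: discrete_channel_def)
  moreover have "0 \<le> prod_kernel W t n xs ys" if "xs \<in> prod_set X t n" "ys \<in> prod_set Y t n" for xs ys
    unfolding prod_kernel_def
    using that ch by (intro prod_nonneg) (auto simp: prod_set_def discrete_channel_def)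
  moreover have "(\<Sum>ys\<in>prod_set Y t n. prod_kernel W t n xs ys) = 1" if "xs \<in> prod_set X t n" for xs
    unfolding prod_kernel_def sum_prod_set_prod[of "\<lambda>i. W (t + i) (xs ! i)"]
    using that ch by (intro prod.neutral) (auto simp: prod_set_def discrete_channel_def)
  ultimately show ?thesis by (simp add: discrete_channel_def)
qed

text \<open>The product of optimal single-letter inputs is admissible for the product channel, and
  the Renyi sum factorises over it.\<close>

lemma sum_capacity_le_prod_capacity:
  assumes t: "1 \<le> t" and \<alpha>: "0 < \<alpha>" "\<alpha> < 1"
  shows "(\<Sum>i<n. renyi_capacity \<alpha> (X (t + i)) (Y (t + i)) (W (t + i))) \<le> prod_capacity \<alpha> X Y W t n"
proof -
  define C where "C i = renyi_capacity \<alpha> (X (t + i)) (Y (t + i)) (W (t + i))" for i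
  have ch: "discrete_channel (X (t + i)) (Y (t + i)) (W (t + i))" for i using channels t by simp
  have "\<exists>p. is_dist (X (t + i)) p \<and> renyi_sum \<alpha> (X (t + i)) (Y (t + i)) (W (t + i)) p = exp (- ((1 - \<alpha>) / \<alpha> * C i))" for i
  proof -
    obtain p where p: "is_dist (X (t + i)) p" "C i = - (\<alpha> / (1 - \<alpha>) * ln (renyi_sum \<alpha> (X (t + i)) (Y (t + i)) (W (t + i)) p))"
      unfolding C_def by (rule renyi_capacity_attained[OF ch[of i] \<alpha>]) blast
    then show ?thesis using renyi_sum_pos[OF ch \<alpha> p(1)] \<alpha> by (intro exI[of _ p]) simp
  qed
  then obtain p where p: "\<And>i. is_dist (X (t + i)) (p i)"
    "\<And>i. renyi_sum \<alpha> (X (t + i)) (Y (t + i)) (W (t + i)) (p i) = exp (- ((1 - \<alpha>) / \<alpha> * C i))"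
    by metis
  define pp where "pp xs = (\<Prod>i<n. p i (xs ! i))" for xs
  have "is_dist (prod_set X t n) pp"
    unfolding is_dist_def
  proof (intro conjI ballI)
    fix xs assume "xs \<in> prod_set X t n"
    then show "0 \<le> pp xs" unfolding pp_def using p(1)
      by (intro prod_nonneg) (auto simp: prod_set_def is_dist_def)
  next
    show "(\<Sum>xs\<in>prod_set X t n. pp xs) = 1"
      unfolding pp_def sum_prod_set_prod using p(1) by (simp add: is_dist_def)
  qed
  then have "exp (- ((1 - \<alpha>) / \<alpha> * prod_capacity \<alpha> X Y W t n)) \<le> renyi_sum \<alpha> (prod_set X t n) (prod_set Y t n) (prod_kernel W t n) pp"
    unfolding prod_capacity_def by (rule renyi_sum_capacity_le[OF product_channel[OF t] \<alpha>])
  also have "\<dots> = (\<Prod>i<n. exp (- ((1 - \<alpha>) / \<alpha> * C i)))"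
  proof -
    have "(\<Sum>xs\<in>prod_set X t n. pp xs * prod_kernel W t n xs ys powr \<alpha>) =
        (\<Prod>i<n. \<Sum>x\<in>X (t + i). p i x * W (t + i) x (ys ! i) powr \<alpha>)"
      if ys: "ys \<in> prod_set Y t n" for ys
    proof -
      have "(\<Sum>xs\<in>prod_set X t n. pp xs * prod_kernel W t n xs ys powr \<alpha>) =
          (\<Sum>xs\<in>prod_set X t n. \<Prod>i<n. p i (xs ! i) * W (t + i) (xs ! i) (ys ! i) powr \<alpha>)"
        unfolding pp_def prod_kernel_def prod.distrib
        using ys ch by (intro sum.cong) (auto simp: prod_powr_distrib prod_set_def discrete_channel_def)
      then show ?thesis using sum_prod_set_prod[of "\<lambda>i x. p i x * W (t + i) x (ys ! i) powr \<alpha>"] by simp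
    qed
    then have "renyi_sum \<alpha> (prod_set X t n) (prod_set Y t n) (prod_kernel W t n) pp =
      (\<Sum>ys\<in>prod_set Y t n. \<Prod>i<n. (\<Sum>x\<in>X (t + i). p i x * W (t + i) x (ys ! i) powr \<alpha>) powr (1 / \<alpha>))"
      unfolding renyi_sum_def
      by (intro sum.cong refl) (simp add: prod_powr_distrib)
    also have "\<dots> = (\<Prod>i<n. renyi_sum \<alpha> (X (t + i)) (Y (t + i)) (W (t + i)) (p i))"
      using sum_prod_set_prod[of "\<lambda>i y. (\<Sum>x\<in>X (t + i). p i x * W (t + i) x y powr \<alpha>) powr (1 / \<alpha>)"]
      by (simp add: renyi_sum_def)
    finally show ?thesis by (simp add: p)
  qed
  also have "\<dots> = exp (- ((1 - \<alpha>) / \<alpha> * (\<Sum>i<n. C i)))"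
    unfolding sum_distrib_left sum_negf[symmetric] by (rule exp_sum[symmetric]) simp
  finally have "(1 - \<alpha>) / \<alpha> * (\<Sum>i<n. C i) \<le> (1 - \<alpha>) / \<alpha> * prod_capacity \<alpha> X Y W t n" by simp
  moreover have "0 < (1 - \<alpha>) / \<alpha>" using \<alpha> by simp
  ultimately show ?thesis unfolding C_def[symmetric] by (rule mult_left_le_imp_le)
qed

text \<open>The product of the single-letter centers works. At each time the affinity bound holds
  for every input letter, hence also for the letter chosen from the past outputs; summing out the
  last output multiplies the bounds, so feedback does not enlarge the divergence.\<close>

lemma feedback_center_exists:
  assumes t: "1 \<le> t" and \<alpha>: "0 < \<alpha>" "\<alpha> < 1"
  shows "\<exists>q. is_dist (prod_set Y t n) q \<and> (\<forall>e\<in>strategies X Y t n.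
    exp (- ((1 - \<alpha>) * prod_capacity \<alpha> X Y W t n)) \<le> affinity (prod_set Y t n) (feedback_kernel W t n e) q \<alpha>)"
proof -
  define C where "C i = renyi_capacity \<alpha> (X (t + i)) (Y (t + i)) (W (t + i))" for i
  have ch: "discrete_channel (X (t + i)) (Y (t + i)) (W (t + i))" for i using channels t by simp
  have "\<exists>q. is_dist (Y (t + i)) q \<and> (\<forall>x\<in>X (t + i). exp (- ((1 - \<alpha>) * C i)) \<le> affinity (Y (t + i)) (W (t + i) x) q \<alpha>)" for i
    unfolding C_def by (rule renyi_center_exists[OF ch \<alpha>])
  then obtain q where q: "\<And>i. is_dist (Y (t + i)) (q i)"
    "\<And>i x. x \<in> X (t + i) \<Longrightarrow> exp (- ((1 - \<alpha>) * C i)) \<le> affinity (Y (t + i)) (W (t + i) x) (q i) \<alpha>"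
    by metis
  define Q where "Q m ys = (\<Prod>i<m. q i (ys ! i))" for m ys
  have "is_dist (prod_set Y t n) (Q n)"
    unfolding is_dist_def
  proof (intro conjI ballI)
    fix ys assume "ys \<in> prod_set Y t n"
    then show "0 \<le> Q n ys" unfolding Q_def using q(1)
      by (intro prod_nonneg) (auto simp: prod_set_def is_dist_def)
  next
    show "(\<Sum>ys\<in>prod_set Y t n. Q n ys) = 1"
      unfolding Q_def sum_prod_set_prod using q(1) by (simp add: is_dist_def)
  qed
  moreover have "exp (- ((1 - \<alpha>) * (\<Sum>i<n. C i))) \<le> affinity (prod_set Y t n) (feedback_kernel W t n e) (Q n) \<alpha>"
    if "e \<in> strategies X Y t n" for e
    using that
  proof (induction n)
    case (Suc n)
    have e: "e \<in> strategies X Y t n" using Suc.prems by (simp add: strategies_def)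
    have "exp (- ((1 - \<alpha>) * (\<Sum>i<Suc n. C i))) = exp (- ((1 - \<alpha>) * (\<Sum>i<n. C i))) * exp (- ((1 - \<alpha>) * C n))"
      by (simp add: distrib_left flip: exp_add)
    also have "\<dots> \<le> affinity (prod_set Y t n) (feedback_kernel W t n e) (Q n) \<alpha> * exp (- ((1 - \<alpha>) * C n))"
      using Suc.IH[OF e] by (intro mult_right_mono) auto
    also have "\<dots> = (\<Sum>a\<in>prod_set Y t n. feedback_kernel W t n e a powr \<alpha> * Q n a powr (1 - \<alpha>) * exp (- ((1 - \<alpha>) * C n)))"
      by (simp add: affinity_def sum_distrib_right)
    also have "\<dots> \<le> (\<Sum>a\<in>prod_set Y t n. feedback_kernel W t n e a powr \<alpha> * Q n a powr (1 - \<alpha>) *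
        affinity (Y (t + n)) (W (t + n) (e n a)) (q n) \<alpha>)"
      using Suc.prems by (intro sum_mono mult_left_mono q(2)) (auto simp: strategies_def)
    also have "\<dots> = affinity (prod_set Y t (Suc n)) (feedback_kernel W t (Suc n) e) (Q (Suc n)) \<alpha>"
      unfolding affinity_def sum_prod_set_Suc sum_distrib_left
    proof (intro sum.cong refl)
      fix a y assume "a \<in> prod_set Y t n"
      then have a: "length a = n" by (simp add: prod_set_def)
      have "Q (Suc n) (a @ [y]) = Q n a * q n y" using a by (simp add: Q_def nth_append)
      then show "feedback_kernel W t n e a powr \<alpha> * Q n a powr (1 - \<alpha>) * (W (t + n) (e n a) y powr \<alpha> * q n y powr (1 - \<alpha>))
         = feedback_kernel W t (Suc n) e (a @ [y]) powr \<alpha> * Q (Suc n) (a @ [y]) powr (1 - \<alpha>)"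
        by (simp add: feedback_kernel_Suc[OF a] powr_mult)
    qed
    finally show ?case .
  qed (simp add: affinity_def feedback_kernel_def Q_def)
  moreover have "exp (- ((1 - \<alpha>) * prod_capacity \<alpha> X Y W t n)) \<le> exp (- ((1 - \<alpha>) * (\<Sum>i<n. C i)))"
    using sum_capacity_le_prod_capacity[OF t \<alpha>, of n] \<alpha> by (simp add: C_def)
  ultimately show ?thesis by (intro exI[of _ "Q n"]) (blast intro: order_trans)
qed

end

section \<open>Concatenation of blocks\<close>

text \<open>The second bound is uniform in the past \<open>a\<close>, so summing out the second
  block leaves the constant factor \<open>exp (s * a2)\<close>.\<close>

lemma moment_dominated_append:
  fixes Y :: "nat \<Rightarrow> 'b set"
  assumes "0 \<le> s"
    and 1: "moment_dominated (prod_set Y t m) s V1 U1 a1"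
    and 2: "\<And>a. a \<in> prod_set Y t m \<Longrightarrow> moment_dominated (prod_set Y (t + m) k) s (V2 a) (U2 a) a2"
    and nn: "\<And>a. a \<in> prod_set Y t m \<Longrightarrow> 0 \<le> V1 a"
      "\<And>a b. a \<in> prod_set Y t m \<Longrightarrow> b \<in> prod_set Y (t + m) k \<Longrightarrow> 0 \<le> V2 a b"
    and V: "\<And>a b. a \<in> prod_set Y t m \<Longrightarrow> b \<in> prod_set Y (t + m) k \<Longrightarrow> V (a @ b) = V1 a * V2 a b"
    and U: "\<And>a b. a \<in> prod_set Y t m \<Longrightarrow> b \<in> prod_set Y (t + m) k \<Longrightarrow> U (a @ b) = U1 a * U2 a b"
  shows "moment_dominated (prod_set Y t (m + k)) s V U (a1 + a2)"
  unfolding moment_dominated_def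
proof (intro conjI ballI impI)
  fix y assume y: "y \<in> prod_set Y t (m + k)" "0 < V y"
  obtain a b where ab: "y = a @ b" "a \<in> prod_set Y t m" "b \<in> prod_set Y (t + m) k"
  proof
    show "y = take m y @ drop m y" by simp
    have "length (take m y) = m" using y by (simp add: prod_set_def)
    from append_in_prod_set[OF this, of "drop m y" Y t k] y
    show "take m y \<in> prod_set Y t m" "drop m y \<in> prod_set Y (t + m) k" by auto
  qed
  then have "0 < V1 a" "0 < V2 a b"
    using y(2) nn(1)[OF ab(2)] nn(2)[OF ab(2,3)] V[OF ab(2,3)] ab(1)
    by (metis less_eq_real_def mult_zero_left less_irrefl, metis less_eq_real_def mult_zero_right less_irrefl)
  then show "0 < U y"
    using 1 2[OF ab(2)] ab(2,3) unfolding ab(1) U[OF ab(2,3)] moment_dominated_def by simp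
next
  have "(\<Sum>y\<in>prod_set Y t (m + k). V y * (V y / U y) powr s) =
    (\<Sum>a\<in>prod_set Y t m. V1 a * (V1 a / U1 a) powr s *
       (\<Sum>b\<in>prod_set Y (t + m) k. V2 a b * (V2 a b / U2 a b) powr s))"
    unfolding sum_prod_set_add sum_distrib_left
    by (intro sum.cong refl) (simp add: V U powr_mult powr_divide mult_ac)
  also have "\<dots> \<le> (\<Sum>a\<in>prod_set Y t m. V1 a * (V1 a / U1 a) powr s * exp (s * a2))"
    using 2 nn by (intro sum_mono mult_left_mono) (auto simp: moment_dominated_def)
  also have "\<dots> = (\<Sum>a\<in>prod_set Y t m. V1 a * (V1 a / U1 a) powr s) * exp (s * a2)"
    by (simp add: sum_distrib_right)
  also have "\<dots> \<le> exp (s * a1) * exp (s * a2)"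
    using 1 by (intro mult_right_mono) (auto simp: moment_dominated_def)
  finally show "(\<Sum>y\<in>prod_set Y t (m + k). V y * (V y / U y) powr s) \<le> exp (s * (a1 + a2))"
    by (simp add: distrib_left exp_add)
qed

lemma is_dist_append:
  assumes "is_dist (prod_set Y t m) V1" "\<And>a. a \<in> prod_set Y t m \<Longrightarrow> is_dist (prod_set Y (t + m) k) (V2 a)"
  shows "is_dist (prod_set Y t (m + k)) (\<lambda>ys. V1 (take m ys) * V2 (take m ys) (drop m ys))"
  unfolding is_dist_def
proof (intro conjI ballI)
  fix y assume y: "y \<in> prod_set Y t (m + k)"
  have "length (take m y) = m" using y by (simp add: prod_set_def)
  from append_in_prod_set[OF this, of "drop m y" Y t k] y
  have "take m y \<in> prod_set Y t m" "drop m y \<in> prod_set Y (t + m) k" by auto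
  then show "0 \<le> V1 (take m y) * V2 (take m y) (drop m y)"
    using assms by (simp add: is_dist_def)
next
  have "(\<Sum>ys\<in>prod_set Y t (m + k). V1 (take m ys) * V2 (take m ys) (drop m ys)) =
     (\<Sum>a\<in>prod_set Y t m. V1 a * (\<Sum>b\<in>prod_set Y (t + m) k. V2 a b))"
    unfolding sum_prod_set_add sum_distrib_left by (intro sum.cong refl) (auto simp: prod_set_def)
  then show "(\<Sum>ys\<in>prod_set Y t (m + k). V1 (take m ys) * V2 (take m ys) (drop m ys)) = 1"
    using assms by (simp add: is_dist_def)
qed

text \<open>The reference measure \<open>Q\<close> must not depend on the strategy, whereas the auxiliary
  measure \<open>V\<close> may.\<close>

definition feedback_dominated ::
  "(nat \<Rightarrow> 'a set) \<Rightarrow> (nat \<Rightarrow> 'b set) \<Rightarrow> (nat \<Rightarrow> 'a \<Rightarrow> 'b \<Rightarrow> real) \<Rightarrow> nat \<Rightarrow> nat \<Rightarrow> real \<Rightarrow> real \<Rightarrow> real \<Rightarrow> bool" where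
  "feedback_dominated X Y W t m s a d \<longleftrightarrow> (\<exists>Q. is_dist (prod_set Y t m) Q \<and>
     (\<forall>e\<in>strategies X Y t m. \<exists>V. is_dist (prod_set Y t m) V \<and>
        moment_dominated (prod_set Y t m) s V Q a \<and>
        moment_dominated (prod_set Y t m) s V (feedback_kernel W t m e) d))"

lemma feedback_dominated_mono:
  assumes "feedback_dominated X Y W t m s a d" "a \<le> a'" "d \<le> d'" "0 \<le> s"
  shows "feedback_dominated X Y W t m s a' d'"
proof -
  have "moment_dominated (prod_set Y t m) s V Q a \<Longrightarrow> moment_dominated (prod_set Y t m) s V Q a'"
    "moment_dominated (prod_set Y t m) s V Q d \<Longrightarrow> moment_dominated (prod_set Y t m) s V Q d'" for V Q
    using assms moment_dominated_mono by blast+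
  then show ?thesis using assms(1) unfolding feedback_dominated_def by blast
qed

text \<open>Each first-block output \<open>a\<close> leaves a strategy \<open>rest a\<close> for the
  second block, and the auxiliary measure \<open>V2 a\<close> is chosen for it. The reference
  measure remains the fixed product of \<open>Q1\<close> and \<open>Q2\<close>.\<close>

lemma feedback_dominated_append:
  assumes s: "0 \<le> s" and 1: "feedback_dominated X Y W t m s a1 d1"
    and 2: "feedback_dominated X Y W (t + m) k s a2 d2"
  shows "feedback_dominated X Y W t (m + k) s (a1 + a2) (d1 + d2)"
proof -
  obtain Q1 where Q1: "is_dist (prod_set Y t m) Q1"
    "\<And>e. e \<in> strategies X Y t m \<Longrightarrow> \<exists>V. is_dist (prod_set Y t m) V \<and>
        moment_dominated (prod_set Y t m) s V Q1 a1 \<and>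
        moment_dominated (prod_set Y t m) s V (feedback_kernel W t m e) d1"
    using 1 unfolding feedback_dominated_def by blast
  obtain Q2 where Q2: "is_dist (prod_set Y (t + m) k) Q2"
    "\<And>e. e \<in> strategies X Y (t + m) k \<Longrightarrow> \<exists>V. is_dist (prod_set Y (t + m) k) V \<and>
        moment_dominated (prod_set Y (t + m) k) s V Q2 a2 \<and>
        moment_dominated (prod_set Y (t + m) k) s V (feedback_kernel W (t + m) k e) d2"
    using 2 unfolding feedback_dominated_def by blast
  define Q where "Q ys = Q1 (take m ys) * Q2 (drop m ys)" for ys
  have "is_dist (prod_set Y t (m + k)) Q"
    unfolding Q_def using Q1 Q2 by (intro is_dist_append[where ?V2.0 = "\<lambda>_. Q2"])
  moreover have "\<exists>V. is_dist (prod_set Y t (m + k)) V \<and>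
        moment_dominated (prod_set Y t (m + k)) s V Q (a1 + a2) \<and>
        moment_dominated (prod_set Y t (m + k)) s V (feedback_kernel W t (m + k) e) (d1 + d2)"
    if e: "e \<in> strategies X Y t (m + k)" for e
  proof -
    obtain V1 where V1: "is_dist (prod_set Y t m) V1" "moment_dominated (prod_set Y t m) s V1 Q1 a1"
        "moment_dominated (prod_set Y t m) s V1 (feedback_kernel W t m e) d1"
      using Q1(2)[OF strategies_append(1)[OF e]] by blast
    define rest where "rest a = (\<lambda>i ys. e (m + i) (a @ ys))" for a
    have "\<forall>a\<in>prod_set Y t m. \<exists>V. is_dist (prod_set Y (t + m) k) V \<and>
        moment_dominated (prod_set Y (t + m) k) s V Q2 a2 \<and>
        moment_dominated (prod_set Y (t + m) k) s V (feedback_kernel W (t + m) k (rest a)) d2"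
      using Q2(2)[OF strategies_append(2)[OF e]] by (simp add: rest_def)
    then obtain V2 where V2: "\<And>a. a \<in> prod_set Y t m \<Longrightarrow> is_dist (prod_set Y (t + m) k) (V2 a)"
      "\<And>a. a \<in> prod_set Y t m \<Longrightarrow> moment_dominated (prod_set Y (t + m) k) s (V2 a) Q2 a2"
      "\<And>a. a \<in> prod_set Y t m \<Longrightarrow> moment_dominated (prod_set Y (t + m) k) s (V2 a) (feedback_kernel W (t + m) k (rest a)) d2"
      by metis
    define V where "V ys = V1 (take m ys) * V2 (take m ys) (drop m ys)" for ys
    have len: "length a = m" if "a \<in> prod_set Y t m" for a using that by (simp add: prod_set_def)
    have nn: "0 \<le> V1 a" "0 \<le> V2 a b" if "a \<in> prod_set Y t m" "b \<in> prod_set Y (t + m) k" for a b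
      using that V1(1) V2(1)[of a] by (auto simp: is_dist_def)
    have nn1: "0 \<le> V1 a" if "a \<in> prod_set Y t m" for a
      using that V1(1) by (auto simp: is_dist_def)
    have "is_dist (prod_set Y t (m + k)) V"
      unfolding V_def using V1 V2 by (intro is_dist_append)
    moreover have "moment_dominated (prod_set Y t (m + k)) s V Q (a1 + a2)"
      using nn nn1 by (intro moment_dominated_append[OF s V1(2) V2(2)]) (auto simp: V_def Q_def len)
    moreover have "moment_dominated (prod_set Y t (m + k)) s V (feedback_kernel W t (m + k) e) (d1 + d2)"
      using nn nn1 by (intro moment_dominated_append[OF s V1(3) V2(3)])
        (auto simp: V_def len feedback_kernel_append rest_def)
    ultimately show ?thesis by blast
  qed
  ultimately show ?thesis unfolding feedback_dominated_def by blast
qed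

text \<open>Blocks of length \<open>l\<close> are cut off until a rest of length at least
  \<open>l\<close> and below \<open>2 * l\<close> remains, so there is no short last block. At most
  \<open>m / l\<close> blocks arise, each paying the constants \<open>c\<close> and
  \<open>c'\<close> once.\<close>

lemma feedback_dominated_blocks:
  assumes s: "0 \<le> s" and l: "1 \<le> (l::nat)" and c: "0 \<le> c" "0 \<le> c'"
    and block: "\<And>t m. 1 \<le> t \<Longrightarrow> l \<le> m \<Longrightarrow> m < 2 * l \<Longrightarrow>
      feedback_dominated X Y W t m s (real m * a + c) (real m * b + c')"
    and "1 \<le> t" "l \<le> m"
  shows "feedback_dominated X Y W t m s (real m * a + real m / real l * c) (real m * b + real m / real l * c')"
  using assms(6,7)
proof (induction m arbitrary: t rule: less_induct)
  case (less m)
  have ml: "1 \<le> real m / real l" using less.prems l by simp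
  show ?case
  proof (cases "m < 2 * l")
    case True
    have "1 * c \<le> real m / real l * c" "1 * c' \<le> real m / real l * c'"
      using ml c by (intro mult_right_mono; simp)+
    then show ?thesis
      by (intro feedback_dominated_mono[OF block[OF less.prems True] _ _ s]) simp_all
  next
    case False
    define k where "k = m - l"
    have k: "k < m" "l \<le> k" "m = l + k" using False l by (auto simp: k_def)
    have "feedback_dominated X Y W (t + l) k s (real k * a + real k / real l * c) (real k * b + real k / real l * c')"
      using less.IH[OF k(1), of "t + l"] k less.prems by auto
    then have "feedback_dominated X Y W t (l + k) s ((real l * a + c) + (real k * a + real k / real l * c))
        ((real l * b + c') + (real k * b + real k / real l * c'))"
      using less.prems l by (intro feedback_dominated_append[OF s] block) auto
    moreover have "(real l * a + c) + (real k * a + real k / real l * c) = real m * a + real m / real l * c"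
      "(real l * b + c') + (real k * b + real k / real l * c') = real m * b + real m / real l * c'"
      using l by (simp_all add: k(3) field_simps)
    ultimately show ?thesis by (simp add: k(3))
  qed
qed

text \<open>The average dominates \<open>q b / N\<close> pointwise; the factor
  \<open>(1 / N) powr (1 - b)\<close> raises the divergence bound by \<open>ln N\<close>.\<close>

lemma mixture_affinity:
  fixes q :: "real \<Rightarrow> 'y \<Rightarrow> real"
  assumes A: "finite A" "b \<in> A" "b < 1" and \<Omega>: "finite \<Omega>"
    and q: "\<And>a. a \<in> A \<Longrightarrow> is_dist \<Omega> (q a)"
    and N: "real (card A) \<le> N" and bd: "exp (- ((1 - b) * \<gamma>)) \<le> affinity \<Omega> w (q b) b"
  shows "exp (- ((1 - b) * (\<gamma> + ln N))) \<le> affinity \<Omega> w (\<lambda>y. (\<Sum>a\<in>A. q a y) / real (card A)) b"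
proof -
  have N0: "0 < real (card A)" using A card_gt_0_iff by auto
  then have N1: "0 < N" using N by linarith
  have "exp (- ((1 - b) * (\<gamma> + ln N))) = exp (- ((1 - b) * \<gamma>)) * (1 / N) powr (1 - b)"
    using N1 by (simp add: powr_def ln_div algebra_simps flip: exp_add)
  also have "\<dots> \<le> affinity \<Omega> w (q b) b * (1 / N) powr (1 - b)"
    using bd by (intro mult_right_mono) auto
  also have "\<dots> = (\<Sum>y\<in>\<Omega>. w y powr b * (q b y / N) powr (1 - b))"
    unfolding affinity_def sum_distrib_right by (simp add: powr_divide)
  also have "\<dots> \<le> affinity \<Omega> w (\<lambda>y. (\<Sum>a\<in>A. q a y) / real (card A)) b"
    unfolding affinity_def
  proof (intro sum_mono mult_left_mono powr_mono2 frac_le)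
    fix y assume y: "y \<in> \<Omega>"
    then have qn: "0 \<le> q a y" if "a \<in> A" for a using q that by (auto simp: is_dist_def)
    show "q b y \<le> (\<Sum>a\<in>A. q a y)" using A qn by (intro member_le_sum) auto
    show "0 \<le> (\<Sum>a\<in>A. q a y)" using qn by (intro sum_nonneg)
    show "0 \<le> q b y / N" using qn A N1 by auto
  qed (use A N N0 in auto)
  finally show ?thesis .
qed

lemma mixture_is_dist:
  assumes "finite A" "A \<noteq> {}" "\<And>a. a \<in> A \<Longrightarrow> is_dist \<Omega> (q a)"
  shows "is_dist \<Omega> (\<lambda>y. (\<Sum>a\<in>A. q a y) / real (card A))"
proof -
  have "(\<Sum>y\<in>\<Omega>. \<Sum>a\<in>A. q a y) = (\<Sum>a\<in>A. \<Sum>y\<in>\<Omega>. q a y)" by (rule sum.swap)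
  also have "\<dots> = real (card A)" using assms by (simp add: is_dist_def)
  finally show ?thesis using assms
    by (auto simp: is_dist_def sum_nonneg simp flip: sum_divide_distrib)
qed

section \<open>Domination on one block, and the change of measure to the channel\<close>

context
  fixes X :: "nat \<Rightarrow> 'a set" and Y :: "nat \<Rightarrow> 'b set" and W :: "nat \<Rightarrow> 'a \<Rightarrow> 'b \<Rightarrow> real"
  assumes channels: "\<forall>t\<ge>1. discrete_channel (X t) (Y t) (W t)"
begin

text \<open>Averaging the centers over the grid \<open>A\<close> yields one \<open>Q\<close>,
  independent of the strategy, whose divergence bound at every grid order is the capacity plus
  \<open>ln N\<close>. The tilted measure is then built for each strategy against this
  \<open>Q\<close>.\<close>

lemma feedback_dominated_block:
  assumes t: "1 \<le> t" and A: "finite A" "\<alpha>0 \<in> A" "A \<subseteq> {\<alpha>0..<1}" and N: "real (card A) \<le> N"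
    and cap: "\<And>a. a \<in> A \<Longrightarrow> prod_capacity a X Y W t m + ln N \<le> \<Gamma> a"
    and mesh: "\<And>\<alpha>. \<alpha>0 \<le> \<alpha> \<Longrightarrow> \<alpha> \<le> 1 - \<eta> \<Longrightarrow> \<exists>a\<in>A. \<alpha> \<le> a \<and> a \<le> \<alpha> + \<delta>"
    and \<alpha>0: "0 < \<alpha>0" and \<eta>: "0 < \<eta>" "\<alpha>0 \<le> 1 - \<eta>" and \<delta>: "0 \<le> \<delta>"
    and \<Gamma>: "\<And>a. a \<in> A \<Longrightarrow> \<Gamma> a \<le> \<Gamma>max" "0 \<le> \<Gamma>max" "\<Gamma> \<alpha>0 \<le> \<rho>" "0 \<le> \<rho>"
    and d: "\<And>a. a \<in> A \<Longrightarrow> (1 - a) / a * (\<Gamma> a - \<rho>) + \<delta> / \<alpha>0^2 * \<Gamma>max \<le> d" "\<eta> / \<alpha>0 * \<Gamma>max \<le> d"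
    and B: "(\<Gamma>max + 1 / \<eta>) / \<alpha>0 \<le> B" and s: "0 < s" "s * B \<le> 1 / 2"
  shows "feedback_dominated X Y W t m s (\<rho> + 23 * s * B^2) (d + 23 * s * B^2)"
proof -
  have fin: "finite (prod_set Y t m)" by (rule finite_output_set[OF channels t])
  have "\<exists>q. is_dist (prod_set Y t m) q \<and> (\<forall>e\<in>strategies X Y t m.
      exp (- ((1 - a) * prod_capacity a X Y W t m)) \<le> affinity (prod_set Y t m) (feedback_kernel W t m e) q a)"
    if "a \<in> A" for a
    using that A \<alpha>0 by (intro feedback_center_exists[OF channels t]) auto
  then obtain q where q: "\<And>a. a \<in> A \<Longrightarrow> is_dist (prod_set Y t m) (q a)"
    "\<And>a e. a \<in> A \<Longrightarrow> e \<in> strategies X Y t m \<Longrightarrow> exp (- ((1 - a) * prod_capacity a X Y W t m))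
      \<le> affinity (prod_set Y t m) (feedback_kernel W t m e) (q a) a"
    by metis
  define Q where "Q = (\<lambda>y. (\<Sum>a\<in>A. q a y) / real (card A))"
  have Q: "is_dist (prod_set Y t m) Q"
    unfolding Q_def using A q by (intro mixture_is_dist) auto
  have "\<exists>V. is_dist (prod_set Y t m) V \<and> moment_dominated (prod_set Y t m) s V Q (\<rho> + 23 * s * B^2)
    \<and> moment_dominated (prod_set Y t m) s V (feedback_kernel W t m e) (d + 23 * s * B^2)"
    if e: "e \<in> strategies X Y t m" for e
  proof (rule exists_moment_dominated[OF fin feedback_kernel_dist[OF channels t e] Q A(2,3) _ mesh \<alpha>0 \<eta> \<delta> \<Gamma> d B s])
    fix a assume a: "a \<in> A"
    then have a1: "a < 1" using A by auto
    have "exp (- ((1 - a) * \<Gamma> a)) \<le> exp (- ((1 - a) * (prod_capacity a X Y W t m + ln N)))"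
      using cap[OF a] a1 by simp
    also have "\<dots> \<le> affinity (prod_set Y t m) (feedback_kernel W t m e) Q a"
      unfolding Q_def using A a a1 fin q N e by (intro mixture_affinity) auto
    finally show "exp (- ((1 - a) * \<Gamma> a)) \<le> affinity (prod_set Y t m) (feedback_kernel W t m e) Q a" .
  qed
  then show ?thesis using Q unfolding feedback_dominated_def by blast
qed

text \<open>For each message, the \<open>V\<close>-mass of correct decoding is bounded through
  \<open>Q\<close> and that of the error event through the channel, and the two masses add up to
  one. Averaging over messages turns the \<open>Q\<close>-masses into \<open>L / M\<close>.\<close>

lemma fb_error_ge:
  assumes dom: "feedback_dominated X Y W 1 n s a d" and s: "0 < s" and code: "fb_code X Y n M L f \<psi>"
  shows "exp (- (d + t)) * (1 - 2 * exp (- s * t) - exp (a + t) * (real L / real M)) \<le> fb_error Y W n M f \<psi>"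
proof -
  let ?\<Omega> = "prod_set Y 1 n"
  have fin: "finite ?\<Omega>" by (rule finite_output_set[OF channels]) simp
  have M: "0 < real M" and f: "\<And>m. m \<in> {1..M} \<Longrightarrow> f m \<in> fb_inputs X Y n"
    and \<psi>: "\<And>ys. ys \<in> ?\<Omega> \<Longrightarrow> \<psi> ys \<subseteq> {1..M} \<and> card (\<psi> ys) = L"
    using code by (auto simp: fb_code_def)
  obtain Q where Q: "is_dist ?\<Omega> Q" "\<And>e. e \<in> strategies X Y 1 n \<Longrightarrow> \<exists>V. is_dist ?\<Omega> V \<and>
        moment_dominated ?\<Omega> s V Q a \<and> moment_dominated ?\<Omega> s V (feedback_kernel W 1 n e) d"
    using dom unfolding feedback_dominated_def by blast
  define A where "A m = {ys \<in> ?\<Omega>. m \<in> \<psi> ys}" for m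
  define A' where "A' m = {ys \<in> ?\<Omega>. m \<notin> \<psi> ys}" for m
  have AA: "A m \<union> A' m = ?\<Omega>" "A m \<inter> A' m = {}" "A m \<subseteq> ?\<Omega>" "A' m \<subseteq> ?\<Omega>" for m
    by (auto simp: A_def A'_def)
  have "1 - 2 * exp (- s * t) - exp (a + t) * sum Q (A m) \<le> exp (d + t) * (\<Sum>ys\<in>A' m. fb_kernel W n (f m) ys)"
    if m: "m \<in> {1..M}" for m
  proof -
    have e: "(\<lambda>i. f m (i + 1)) \<in> strategies X Y 1 n" using f[OF m] by (simp add: fb_inputs_strategies)
    obtain V where V: "is_dist ?\<Omega> V" "moment_dominated ?\<Omega> s V Q a" "moment_dominated ?\<Omega> s V (fb_kernel W n (f m)) d"
      using Q(2)[OF e] unfolding fb_kernel_eq by blast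
    have "sum V (A m) + sum V (A' m) = 1"
      using V(1) AA sum.union_disjoint[of "A m" "A' m" V] finite_subset[OF _ fin] by (simp add: is_dist_def)
    moreover have "sum V (A m) \<le> exp (- s * t) + exp (a + t) * sum Q (A m)"
      using V Q(1) AA fin s by (intro moment_dominated_Markov[of ?\<Omega>]) (auto simp: is_dist_def)
    moreover have "sum V (A' m) \<le> exp (- s * t) + exp (d + t) * (\<Sum>ys\<in>A' m. fb_kernel W n (f m) ys)"
      using V feedback_kernel_nonneg[OF channels _ e] AA fin s
      by (intro moment_dominated_Markov[of ?\<Omega>]) (auto simp: is_dist_def fb_kernel_eq)
    ultimately show ?thesis by linarith
  qed
  then have "(\<Sum>m\<in>{1..M}. 1 - 2 * exp (- s * t) - exp (a + t) * sum Q (A m)) \<le>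
      (\<Sum>m\<in>{1..M}. exp (d + t) * (\<Sum>ys\<in>A' m. fb_kernel W n (f m) ys))"
    by (intro sum_mono)
  also have "\<dots> = exp (d + t) * (real M * fb_error Y W n M f \<psi>)"
    using M by (simp add: fb_error_def A'_def sum_distrib_left)
  also have "(\<Sum>m\<in>{1..M}. 1 - 2 * exp (- s * t) - exp (a + t) * sum Q (A m)) =
      real M * (1 - 2 * exp (- s * t)) - exp (a + t) * (\<Sum>m\<in>{1..M}. sum Q (A m))"
    by (simp add: sum_subtractf sum_distrib_left)
  \<comment> \<open>Double counting: each output lies in \<open>A m\<close> for exactly the
    \<open>L\<close> messages of its list.\<close>
  also have "(\<Sum>m\<in>{1..M}. sum Q (A m)) = real L"
  proof -
    have "(\<Sum>m\<in>{1..M}. sum Q (A m)) = (\<Sum>m\<in>{1..M}. \<Sum>ys\<in>?\<Omega>. if m \<in> \<psi> ys then Q ys else 0)"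
      unfolding A_def using fin by (simp add: sum.inter_filter)
    also have "\<dots> = (\<Sum>ys\<in>?\<Omega>. \<Sum>m\<in>{1..M}. if m \<in> \<psi> ys then Q ys else 0)" by (rule sum.swap)
    also have "\<dots> = (\<Sum>ys\<in>?\<Omega>. real L * Q ys)"
    proof (intro sum.cong refl)
      fix ys assume "ys \<in> ?\<Omega>"
      then show "(\<Sum>m\<in>{1..M}. if m \<in> \<psi> ys then Q ys else 0) = real L * Q ys"
        using \<psi>[of ys] by (simp add: sum.If_cases Int_absorb1)
    qed
    also have "\<dots> = real L" using Q(1) by (simp add: is_dist_def flip: sum_distrib_left)
    finally show ?thesis .
  qed
  finally have "real M * (1 - 2 * exp (- s * t) - exp (a + t) * (real L / real M)) \<le>
      real M * (exp (d + t) * fb_error Y W n M f \<psi>)"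
    using M by (simp add: algebra_simps)
  then have "1 - 2 * exp (- s * t) - exp (a + t) * (real L / real M) \<le> exp (d + t) * fb_error Y W n M f \<psi>"
    using M by simp
  then have "exp (- (d + t)) * (1 - 2 * exp (- s * t) - exp (a + t) * (real L / real M)) \<le>
      exp (- (d + t)) * (exp (d + t) * fb_error Y W n M f \<psi>)"
    by (intro mult_left_mono) auto
  then show ?thesis by (simp add: mult.assoc[symmetric] flip: exp_add)
qed

end

section \<open>The error bound for a fixed block length\<close>

text \<open>The order is rounded up, because divergence bounds pass from larger to smaller orders.
  The margin \<open>1 / real n \<le> \<eta>\<close> keeps the rounded order below one, and this
  forces the index below \<open>n\<close>.\<close>

lemma grid_mesh:
  fixes \<alpha>0 \<eta> :: real
  assumes n: "0 < (n::nat)" "1 / real n \<le> \<eta>" and \<alpha>: "0 < \<alpha>0" "\<alpha>0 \<le> \<alpha>" "\<alpha> \<le> 1 - \<eta>"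
  shows "\<exists>a\<in>(\<lambda>j. \<alpha>0 + real j / real n) ` {..<n} \<inter> {..<1}. \<alpha> \<le> a \<and> a \<le> \<alpha> + 1 / real n"
proof -
  define j where "j = nat \<lceil>(\<alpha> - \<alpha>0) * real n\<rceil>"
  define a where "a = \<alpha>0 + real j / real n"
  have j: "(\<alpha> - \<alpha>0) * real n \<le> real j" "real j < (\<alpha> - \<alpha>0) * real n + 1"
    unfolding j_def using \<alpha> n by (auto simp: ceiling_less_iff) linarith+
  have "(\<alpha> - \<alpha>0) * real n / real n \<le> real j / real n" "real j / real n < ((\<alpha> - \<alpha>0) * real n + 1) / real n"
    using j n by (intro divide_right_mono divide_strict_right_mono; simp)+
  then have a: "\<alpha> \<le> a" "a < \<alpha> + 1 / real n" using n by (auto simp: a_def add_divide_distrib)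
  have "a < 1" using a n \<alpha> by linarith
  moreover have "j < n"
  proof -
    have "real j / real n < 1" using \<open>a < 1\<close> \<alpha> by (simp add: a_def)
    then show ?thesis using n by simp
  qed
  ultimately show ?thesis using a by (intro bexI[of _ a]) (auto simp: a_def)
qed

context
  fixes X :: "nat \<Rightarrow> 'a set" and Y :: "nat \<Rightarrow> 'b set" and W :: "nat \<Rightarrow> 'a \<Rightarrow> 'b \<Rightarrow> real"
  assumes channels: "\<forall>t\<ge>1. discrete_channel (X t) (Y t) (W t)"
begin

text \<open>With \<open>\<eta> = 1 / l\<close> and \<open>s = 1 / l\<^sup>2\<close>: \<open>C1 * l\<close> bounds the order-\<open>\<alpha>\<close> divergences on a block, \<open>C2 * l\<close> is
  the tail parameter \<open>B\<close> of the log-likelihood ratios, \<open>C3 = 23 * s * B\<^sup>2\<close> the second-order loss per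
  block, and \<open>\<sigma>\<close> the part of the rate sacrificed to concentration.\<close>

lemma fb_error_ge_blocks:
  fixes g :: "real \<Rightarrow> real" and K G \<alpha>0 E :: real and n0 n l M L :: nat
  assumes g: "\<And>a. 0 < a \<Longrightarrow> a < 1 \<Longrightarrow> 0 \<le> g a \<and> g a \<le> G" and K: "0 \<le> K" and \<alpha>0: "0 < \<alpha>0" "\<alpha>0 < 1"
    and unif: "\<And>t m a. 1 \<le> t \<Longrightarrow> n0 \<le> m \<Longrightarrow> 0 < a \<Longrightarrow> a < 1 \<Longrightarrow> \<bar>prod_capacity a X Y W t m - real m * g a\<bar> \<le> K * ln (real m)"
    and code: "fb_code X Y n M L f \<psi>"
  defines "R \<equiv> ln (real M / real L)"
  assumes E: "0 \<le> E" "\<And>a. 0 < a \<Longrightarrow> a < 1 \<Longrightarrow> (1 - a) / a * (prod_capacity a X Y W 1 n - R) \<le> E"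
  defines "C1 \<equiv> 2 * G + 2 * K + 6"
  defines "C2 \<equiv> (C1 + 1) / \<alpha>0"
  defines "C3 \<equiv> 23 * C2^2"
  defines "\<sigma> \<equiv> real n / real l * C3 + 2 * real l ^ 2 + ln 4"
  assumes l: "1 \<le> l" "n0 \<le> l" "l ^ 3 \<le> n" "n \<le> (2 * l) ^ 3" "2 * C2 \<le> real l" "1 / real l \<le> 1 - \<alpha>0"
    and rate: "real n * g \<alpha>0 + \<sigma> + real n / real l * ((K + 1) * ln (real n)) \<le> R"
  shows "exp (- (E + (K * ln (real n) + \<sigma>) / \<alpha>0
      + real n / real l * ((K + 1) * ln (real n) / \<alpha>0 + C1 / \<alpha>0^2 + C1 / \<alpha>0 + C3) + 2 * real l ^ 2 + ln 4))
    \<le> fb_error Y W n M f \<psi>"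
proof -
  have g0: "0 \<le> g \<alpha>0" "g \<alpha>0 \<le> G" using g \<alpha>0 by auto
  have G: "0 \<le> G" using g0 by linarith
  have C: "0 \<le> C1" "0 \<le> C2" "0 \<le> C3" using G K \<alpha>0 by (auto simp: C1_def C2_def C3_def)
  have ln_le: "l \<le> n" using l(1,3) self_le_power[of l 3] by linarith
  have n: "1 \<le> n" using ln_le l by linarith
  have lnn: "0 \<le> ln (real n)" using n by simp
  have \<sigma>: "0 < \<sigma>" unfolding \<sigma>_def using C by (intro add_nonneg_pos add_nonneg_nonneg) auto
  have lr: "1 \<le> real l" using l by simp
  define s where "s = 1 / real l ^ 2"
  \<comment> \<open>\<open>r\<close> and \<open>b\<close> are rate and error exponent per letter;
    \<open>c\<close> is the part of the exponent loss that every block pays once.\<close>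
  define r where "r = (R - \<sigma>) / real n"
  define b where "b = (E + (K * ln (real n) + \<sigma>) / \<alpha>0) / real n"
  define c where "c = (K + 1) * ln (real n) / \<alpha>0 + C1 / \<alpha>0^2 + C1 / \<alpha>0"
  have s: "0 < s" using lr by (simp add: s_def)
  define A where "A = (\<lambda>j. \<alpha>0 + real j / real n) ` {..<n} \<inter> {..<1}"
  have A: "finite A" "\<alpha>0 \<in> A" "A \<subseteq> {\<alpha>0..<1}"
    using n \<alpha>0 by (auto simp: A_def intro!: image_eqI[of _ _ 0])
  have "card A \<le> card ((\<lambda>j. \<alpha>0 + real j / real n) ` {..<n})"
    unfolding A_def by (intro card_mono) auto
  also have "\<dots> \<le> n" using card_image_le[of "{..<n}"] by simp
  finally have cardA: "real (card A) \<le> real n" by simp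
  have mesh: "\<exists>a\<in>A. \<alpha> \<le> a \<and> a \<le> \<alpha> + 1 / real n" if "\<alpha>0 \<le> \<alpha>" "\<alpha> \<le> 1 - 1 / real l" for \<alpha>
    unfolding A_def using that n ln_le l \<alpha>0 by (intro grid_mesh[of _ "1 / real l"]) (auto simp: frac_le)
  have block: "feedback_dominated X Y W t m s (real m * r + C3) (real m * b + (c + C3))"
    if t: "1 \<le> t" and m: "l \<le> m" "m < 2 * l" for t m
  proof -
    have mr: "1 \<le> real m" "real m \<le> 2 * real l" "real m \<le> real n"
    proof -
      show "1 \<le> real m" "real m \<le> 2 * real l" using m l by auto
      show "real m \<le> real n"
      proof (cases "l = 1")
        case False
        then have "2 * l \<le> l * l" using l by simp
        also have "\<dots> \<le> l ^ 3" using l by (simp add: power3_eq_cube)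
        finally show ?thesis using m l by linarith
      qed (use m l n in auto)
    qed
    have lnm: "0 \<le> ln (real m)" "ln (real m) \<le> ln (real n)" using mr by auto
    define \<Gamma> where "\<Gamma> a = real m * g a + K * ln (real m) + ln (real n)" for a
    have \<Gamma>0: "0 \<le> \<Gamma> \<alpha>0" unfolding \<Gamma>_def using g0 K lnm lnn by simp
    \<comment> \<open>The terms of \<open>C1\<close> come from \<open>m \<le> 2 * l\<close>, from
      \<open>ln m \<le> 2 * l\<close>, and from
      \<open>ln n \<le> 3 * ln (2 * l) \<le> 6 * l\<close>.\<close>
    have \<Gamma>max: "\<Gamma> a \<le> C1 * real l" if "a \<in> A" for a
    proof -
      have "g a \<le> G" using g[of a] that A \<alpha>0 by auto
      then have "real m * g a \<le> 2 * real l * G" using mr G by (intro mult_mono') (use g[of a] that A \<alpha>0 in auto)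
      moreover have "K * ln (real m) \<le> K * (2 * real l)"
        using mr K ln_le_minus_one[of "real m"] by (intro mult_left_mono) auto
      moreover have "ln (real n) \<le> 6 * real l"
      proof -
        have "real n \<le> real ((2 * l) ^ 3)" using l(4) of_nat_mono by blast
        then have "ln (real n) \<le> ln ((2 * real l) ^ 3)" using n by (intro ln_mono) auto
        also have "\<dots> = 3 * ln (2 * real l)" by (subst ln_realpow) (use lr in auto)
        also have "\<dots> \<le> 3 * (2 * real l)" using lr ln_le_minus_one[of "2 * real l"] by auto
        finally show ?thesis by simp
      qed
      ultimately show ?thesis by (simp add: \<Gamma>_def C1_def algebra_simps)
    qed
    have ln_block: "K * ln (real m) + ln (real n) \<le> (K + 1) * ln (real n)"
      using mult_left_mono[OF lnm(2) K] by (simp add: algebra_simps)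
    have \<rho>: "\<Gamma> \<alpha>0 \<le> real m * r"
    proof -
      have "\<Gamma> \<alpha>0 \<le> real m * g \<alpha>0 + (K + 1) * ln (real n)" using ln_block by (simp add: \<Gamma>_def)
      \<comment> \<open>As \<open>m \<ge> l\<close>, the loss per block fits into the block's
        proportional share of the rate margin.\<close>
      also have "\<dots> \<le> real m * g \<alpha>0 + real m * ((K + 1) * ln (real n) / real l)"
      proof -
        have "1 * ((K + 1) * ln (real n)) \<le> real m / real l * ((K + 1) * ln (real n))"
          using m l K lnn by (intro mult_right_mono) auto
        then show ?thesis by simp
      qed
      also have "\<dots> = real m * (g \<alpha>0 + (K + 1) * ln (real n) / real l)" by (simp add: distrib_left)
      also have "\<dots> \<le> real m * r"
      proof (rule mult_left_mono)
        have "(g \<alpha>0 + (K + 1) * ln (real n) / real l) * real n \<le> R - \<sigma>"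
          using rate by (simp add: algebra_simps add_divide_distrib)
        then show "g \<alpha>0 + (K + 1) * ln (real n) / real l \<le> r"
          unfolding r_def using n by (simp add: pos_le_divide_eq)
      qed simp
      finally show ?thesis .
    qed
    have "feedback_dominated X Y W t m s (real m * r + 23 * s * (C2 * real l)^2)
        (real m * b + c + 23 * s * (C2 * real l)^2)"
    proof (rule feedback_dominated_block[OF channels t A cardA _ mesh \<alpha>0(1), where \<Gamma> = \<Gamma> and \<Gamma>max = "C1 * real l"])
      fix a assume a: "a \<in> A"
      then have a1: "0 < a" "\<alpha>0 \<le> a" "a < 1" using A \<alpha>0 by auto
      have "\<bar>prod_capacity a X Y W t m - real m * g a\<bar> \<le> K * ln (real m)"
        using unif[OF t _ a1(1,3)] m l by auto
      then show "prod_capacity a X Y W t m + ln (real n) \<le> \<Gamma> a" by (simp add: \<Gamma>_def)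
      show "\<Gamma> a \<le> C1 * real l" by (rule \<Gamma>max[OF a])
      have lam: "0 \<le> (1 - a) / a" "(1 - a) / a \<le> 1 / \<alpha>0" using a1 \<alpha>0 by (auto intro: frac_le)
      \<comment> \<open>The uniform bound is applied a second time, now at full length, to return
        from \<open>g\<close> to the capacity that enters the sphere packing exponent.\<close>
      have cap: "real n * g a \<le> prod_capacity a X Y W 1 n + K * ln (real n)"
        using unif[of 1 n a] a1 ln_le l by auto
      have "\<Gamma> a - real m * r \<le> real m / real n * (real n * g a - (R - \<sigma>)) + (K + 1) * ln (real n)"
        using ln_block n by (simp add: \<Gamma>_def r_def algebra_simps add_divide_distrib diff_divide_distrib)
      also have "\<dots> \<le> real m / real n * ((prod_capacity a X Y W 1 n - R) + (K * ln (real n) + \<sigma>)) + (K + 1) * ln (real n)"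
        using cap by (intro add_right_mono mult_left_mono) auto
      finally have "(1 - a) / a * (\<Gamma> a - real m * r) \<le> (1 - a) / a *
          (real m / real n * ((prod_capacity a X Y W 1 n - R) + (K * ln (real n) + \<sigma>)) + (K + 1) * ln (real n))"
        using lam by (intro mult_left_mono)
      also have "\<dots> = real m / real n * ((1 - a) / a * (prod_capacity a X Y W 1 n - R) + (1 - a) / a * (K * ln (real n) + \<sigma>))
          + (1 - a) / a * ((K + 1) * ln (real n))"
        by (simp only: distrib_left mult.left_commute)
      also have "\<dots> \<le> real m / real n * (E + 1 / \<alpha>0 * (K * ln (real n) + \<sigma>)) + 1 / \<alpha>0 * ((K + 1) * ln (real n))"
        using E(2)[OF a1(1,3)] lam K lnn \<sigma> by (intro add_mono mult_left_mono mult_right_mono) auto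
      also have "\<dots> = real m * b + (K + 1) * ln (real n) / \<alpha>0" by (simp add: b_def)
      finally have 1: "(1 - a) / a * (\<Gamma> a - real m * r) \<le> real m * b + (K + 1) * ln (real n) / \<alpha>0" .
      have "1 / real n / \<alpha>0^2 * (C1 * real l) = (real l / real n) * (C1 / \<alpha>0^2)" by simp
      also have "\<dots> \<le> 1 * (C1 / \<alpha>0^2)" using ln_le n C by (intro mult_right_mono) auto
      finally show "(1 - a) / a * (\<Gamma> a - real m * r) + 1 / real n / \<alpha>0^2 * (C1 * real l) \<le> real m * b + c"
        using 1 divide_nonneg_pos[OF C(1) \<alpha>0(1)] unfolding c_def by linarith
    next
      show "0 < 1 / real l" "\<alpha>0 \<le> 1 - 1 / real l" "0 \<le> 1 / real n" "0 \<le> C1 * real l" "0 < s"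
        using lr l C s by auto
      show "\<Gamma> \<alpha>0 \<le> real m * r" "0 \<le> real m * r" using \<rho> \<Gamma>0 by linarith+
      have "0 \<le> b" unfolding b_def using E K lnn \<sigma> \<alpha>0 by simp
      then show "1 / real l / \<alpha>0 * (C1 * real l) \<le> real m * b + c"
        using lr C \<alpha>0 K lnn by (simp add: c_def)
      show "(C1 * real l + 1 / (1 / real l)) / \<alpha>0 \<le> C2 * real l"
        by (simp add: C2_def field_simps)
      show "s * (C2 * real l) \<le> 1 / 2"
        using l(5) lr by (simp add: s_def power2_eq_square field_simps)
    qed (use mesh in auto)
    moreover have "23 * s * (C2 * real l)^2 = C3"
      using lr by (simp add: s_def C3_def power_mult_distrib)
    ultimately show ?thesis by (simp add: add.assoc)
  qed
  have "feedback_dominated X Y W 1 n s (real n * r + real n / real l * C3) (real n * b + real n / real l * (c + C3))"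
    using C K lnn \<alpha>0 s ln_le by (intro feedback_dominated_blocks[OF _ l(1) _ _ block]) (auto simp: c_def)
  \<comment> \<open>The deviation \<open>2 * real l ^ 2\<close> is matched to
    \<open>s = 1 / real l ^ 2\<close>: each Markov term becomes \<open>exp (- 2)\<close>, at most
    1/4.\<close>
  note bound = fb_error_ge[OF channels this s code, of "2 * real l ^ 2"]
  have "0 < R"
    using rate \<sigma> g0 K lnn by (smt (verit) divide_nonneg_nonneg mult_nonneg_nonneg of_nat_0_le_iff)
  \<comment> \<open>If \<open>M\<close> or \<open>L\<close> were 0, the quotient would be 0 by
    convention and its logarithm 0, against \<open>0 < R\<close>.\<close>
  then have pos: "0 < real M" "0 < real L"
    by (auto simp: R_def intro!: gr0I)
  have st: "- s * (2 * real l ^ 2) = - 2" using lr by (simp add: s_def)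
  \<comment> \<open>By the choice of \<sigma> the exponent is exactly
    \<open>R - ln 4\<close>.\<close>
  have "exp (real n * r + real n / real l * C3 + 2 * real l ^ 2) * (real L / real M) = exp (- ln 4) * (exp R * (real L / real M))"
    using n by (simp add: r_def \<sigma>_def flip: exp_add)
  also have "\<dots> = 1 / 4" unfolding R_def using pos by (simp add: exp_minus)
  finally have e1: "exp (real n * r + real n / real l * C3 + 2 * real l ^ 2) * (real L / real M) = 1 / 4" .
  have e2: "exp (- 2) \<le> (1 / 4 :: real)"
  proof -
    have "(2::real) \<le> exp 1" using exp_ge_add_one_self[of 1] by simp
    then have "2 * 2 \<le> exp 1 * exp (1::real)" by (intro mult_mono) auto
    then have "(4::real) \<le> exp 2" by (simp flip: exp_add)
    then show ?thesis by (simp add: exp_minus field_simps)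
  qed
  let ?d = "real n * b + real n / real l * (c + C3) + 2 * real l ^ 2"
  \<comment> \<open>The final \<open>ln 4\<close> comes from the remaining mass
    \<open>1 - 2 / 4 - 1 / 4\<close>.\<close>
  have "exp (- (?d + ln 4)) = exp (- ?d) * (1 / 4)" by (simp add: exp_diff)
  also have "\<dots> \<le> exp (- ?d) * (1 - 2 * exp (- 2) - 1 / 4)"
    using e2 by (intro mult_left_mono) auto
  also have "\<dots> \<le> fb_error Y W n M f \<psi>" using bound unfolding st e1 .
  also have "real n * b = E + (K * ln (real n) + \<sigma>) / \<alpha>0" using n by (simp add: b_def)
  finally show ?thesis by (simp add: c_def add_ac)
qed

end

text \<open>Order 1 contributes the value 0 to the supremum, which gives nonnegativity; a finite
  exponent is therefore faithfully represented by \<open>real_of_ereal\<close>.\<close>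

lemma sphere_packing_exp_real:
  assumes "sphere_packing_exp R X Y W \<noteq> \<infinity>"
  shows "0 \<le> real_of_ereal (sphere_packing_exp R X Y W)"
    and "0 < \<alpha> \<Longrightarrow> (1 - \<alpha>) / \<alpha> * (renyi_capacity \<alpha> X Y W - R) \<le> real_of_ereal (sphere_packing_exp R X Y W)"
proof -
  have le: "ereal ((1 - \<alpha>) / \<alpha> * (renyi_capacity \<alpha> X Y W - R)) \<le> sphere_packing_exp R X Y W" if "0 < \<alpha>" for \<alpha>
    unfolding sphere_packing_exp_def using that by (intro SUP_upper) auto
  have "0 \<le> sphere_packing_exp R X Y W" using le[of 1] by (simp add: zero_ereal_def)
  then obtain E where E: "sphere_packing_exp R X Y W = ereal E" "0 \<le> E"
    using assms by (cases "sphere_packing_exp R X Y W") auto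
  show "0 \<le> real_of_ereal (sphere_packing_exp R X Y W)" using E by simp
  show "0 < \<alpha> \<Longrightarrow> (1 - \<alpha>) / \<alpha> * (renyi_capacity \<alpha> X Y W - R) \<le> real_of_ereal (sphere_packing_exp R X Y W)"
    using le[of \<alpha>] E by simp
qed

text \<open>For \<open>l \<ge> 1\<close> the cube root lies below \<open>l + 1 \<le> 2 * l\<close>.
  Thus the number of blocks \<open>n / l\<close> and the deviation scale \<open>l ^ 2\<close> are
  both of order \<open>n powr (2/3)\<close>, which is the balance sought.\<close>

lemma floor_cube_root:
  fixes n N :: nat
  defines "l \<equiv> nat \<lfloor>real n powr (1/3)\<rfloor>"
  assumes "N ^ 3 \<le> n" "1 \<le> N"
  shows "N \<le> l" "l ^ 3 \<le> n" "n \<le> (2 * l) ^ 3" "real l ^ 2 \<le> real n powr (2/3)"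
    "real n / real l \<le> 8 * real n powr (2/3)"
proof -
  let ?x = "real n powr (1/3)"
  have n: "1 \<le> n" using assms(2,3) one_le_power[of N 3] by linarith
  have x: "?x ^ 3 = real n" "?x ^ 2 = real n powr (2/3)"
    using n by (simp_all add: powr_power)
  have "real N ^ 3 \<le> ?x ^ 3" using assms(2) unfolding x by (simp flip: of_nat_power)
  then have "real N \<le> ?x" by (simp add: power_mono_iff)
  then show "N \<le> l" unfolding l_def by (simp add: le_nat_iff le_floor_iff)
  then have l1: "1 \<le> l" using assms(3) by simp
  have l: "real l \<le> ?x" "?x < real l + 1" unfolding l_def by simp_all
  have "real l ^ 3 \<le> ?x ^ 3" using l by (intro power_mono) auto
  then have "real l ^ 3 \<le> real n" by (simp only: x(1))
  then show "l ^ 3 \<le> n" by (simp flip: of_nat_power)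
  have "?x ^ 3 \<le> (2 * real l) ^ 3" using l l1 by (intro power_mono) auto
  then have n8: "real n \<le> (2 * real l) ^ 3" by (simp only: x(1))
  then have "real n \<le> real ((2 * l) ^ 3)" by simp
  then show "n \<le> (2 * l) ^ 3" by (simp only: of_nat_le_iff)
  have "real l ^ 2 \<le> ?x ^ 2" using l by (intro power_mono) auto
  then show l2: "real l ^ 2 \<le> real n powr (2/3)" by (simp only: x(2))
  have "real n / real l \<le> 8 * real l ^ 2"
    using n8 l1 by (simp add: divide_le_eq power2_eq_square power3_eq_cube)
  then show "real n / real l \<le> 8 * real n powr (2/3)" using l2 by linarith
qed

section \<open>Asymptotics with blocks of length about the cube root of the code length\<close>

theorem theorem5:
  fixes X :: "nat \<Rightarrow> 'a set" and Y :: "nat \<Rightarrow> 'b set" and W :: "nat \<Rightarrow> 'a \<Rightarrow> 'b \<Rightarrow> real"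
    and g :: "real \<Rightarrow> real" and K :: real and n0 :: nat and \<alpha>0 \<alpha>1 :: real
    and M L :: "nat \<Rightarrow> nat"
    and f :: "nat \<Rightarrow> nat \<Rightarrow> nat \<Rightarrow> 'b list \<Rightarrow> 'a" and \<psi> :: "nat \<Rightarrow> 'b list \<Rightarrow> nat set"
  assumes channels: "\<forall>t\<ge>1. discrete_channel (X t) (Y t) (W t)"
    and g_nonneg: "\<forall>\<alpha>\<in>{0<..<1}. 0 \<le> g \<alpha>"
    and lim_g: "\<forall>\<alpha>\<in>{0<..<1}. (\<lambda>n. prod_capacity \<alpha> X Y W 1 n / real n) \<longlonglongrightarrow> g \<alpha>"
    and lim_1: "((\<lambda>\<alpha>. (1 - \<alpha>) / \<alpha> * g \<alpha>) \<longlongrightarrow> 0) (at_left 1)"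
    and K_nonneg: "0 \<le> K" and n0_pos: "1 \<le> n0"
    and unif: "\<forall>n\<ge>n0. \<forall>\<alpha>\<in>{0<..<1}. \<forall>t\<ge>1.
                 \<bar>prod_capacity \<alpha> X Y W t n - real n * g \<alpha>\<bar> \<le> K * ln (real n)"
    and alphas: "0 < \<alpha>0" "\<alpha>0 < \<alpha>1" "\<alpha>1 < 1"
    and codes: "\<forall>n\<ge>1. fb_code X Y n (M n) (L n) (f n) (\<psi> n)"
    and rate: "\<forall>n\<ge>n0.
        ln (real (M n) / real (L n)) \<le> prod_capacity \<alpha>1 X Y W 1 n \<and>
        prod_capacity \<alpha>0 X Y W 1 n + (K + 1) * real n powr (3/4) * ln (real n)
          \<le> ln (real (M n) / real (L n))"
  shows "\<exists>n1\<ge>n0. \<forall>n\<ge>n1.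
           sphere_packing_exp (ln (real (M n) / real (L n))) (prod_set X 1 n) (prod_set Y 1 n)
              (prod_kernel W 1 n) \<noteq> \<infinity> \<longrightarrow>
           exp (- real_of_ereal (sphere_packing_exp (ln (real (M n) / real (L n)))
                   (prod_set X 1 n) (prod_set Y 1 n) (prod_kernel W 1 n))
                - (6 * K + 1) / \<alpha>0 * real n powr (3/4) * ln (real n))
           \<le> fb_error Y W n (M n) (f n) (\<psi> n)"
proof -
  have \<alpha>0: "0 < \<alpha>0" "\<alpha>0 < 1" using alphas by auto
  \<comment> \<open>The capacity at length \<open>n0\<close> is at most the logarithm of the output
    cardinality, uniformly in the order; the uniform approximation turns this into a bound on
    \<open>g\<close>.\<close>
  define G where "G = (ln (real (card (prod_set Y 1 n0))) + K * ln (real n0)) / real n0"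
  have g: "0 \<le> g a \<and> g a \<le> G" if "0 < a" "a < 1" for a
  proof -
    have "prod_capacity a X Y W 1 n0 \<le> ln (real (card (prod_set Y 1 n0)))"
      unfolding prod_capacity_def using that by (intro renyi_capacity_le_ln_card product_channel[OF channels]) auto
    moreover have "\<bar>prod_capacity a X Y W 1 n0 - real n0 * g a\<bar> \<le> K * ln (real n0)"
      using unif that by auto
    ultimately have "g a * real n0 \<le> ln (real (card (prod_set Y 1 n0))) + K * ln (real n0)"
      by (simp add: mult.commute)
    then show ?thesis using g_nonneg that n0_pos by (simp add: G_def pos_le_divide_eq)
  qed
  have G: "0 \<le> G" using g[OF \<alpha>0] by linarith
  define C1 where "C1 = 2 * G + 2 * K + 6"
  define C2 where "C2 = (C1 + 1) / \<alpha>0"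
  define C3 where "C3 = 23 * C2^2"
  have C: "0 \<le> C1" "0 \<le> C2" "0 \<le> C3" using G K_nonneg \<alpha>0 by (auto simp: C1_def C2_def C3_def)
  define D where "D = (K + 1) / \<alpha>0 + C1 / \<alpha>0^2 + C1 / \<alpha>0 + C3"
  have D: "0 \<le> D" using C K_nonneg \<alpha>0 by (simp add: D_def)
  \<comment> \<open>\<open>T1\<close> collects the rate losses and \<open>T2\<close> the exponent
    losses, in units of \<open>n powr (2/3) * ln n\<close>.\<close>
  define T1 where "T1 = (8 * C3 + 4) + 8 * (K + 1) + K"
  define T2 where "T2 = (K + (8 * C3 + 4)) / \<alpha>0 + 8 * D + 4"
  have T: "0 \<le> T1" "0 \<le> T2" using C D K_nonneg \<alpha>0 by (auto simp: T1_def T2_def)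
  \<comment> \<open>A block length of at least \<open>N\<close> permits the uniform capacity bound,
    makes \<open>s * B \<le> 1/2\<close>, and leaves room for orders up to \<open>1 - 1 / l\<close>
    above \<alpha>0.\<close>
  define N where "N = max n0 (nat \<lceil>max (2 * C2) (1 / (1 - \<alpha>0))\<rceil>)"
  have N: "1 \<le> N" "n0 \<le> N" "2 * C2 \<le> real N" "1 / (1 - \<alpha>0) \<le> real N"
    using n0_pos unfolding N_def by (auto simp: le_max_iff_disj) linarith+
  \<comment> \<open>The power 12 is the inverse of 3/4 - 2/3: from
    \<open>(T1 + T2) ^ 12 \<le> n\<close> all constants fit into the gap between the two powers of
    \<open>n\<close>. The value 3 ensures \<open>ln n \<ge> 1\<close>.\<close>
  define n1 where "n1 = max (N ^ 3) (max 3 (nat \<lceil>(T1 + T2) ^ 12\<rceil>))"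
  have "n0 \<le> n1"
  proof -
    have "N \<le> N ^ 3" using N(1) by (intro self_le_power) auto
    then show ?thesis using N(2) by (simp add: n1_def)
  qed
  moreover have "exp (- real_of_ereal (sphere_packing_exp (ln (real (M n) / real (L n)))
          (prod_set X 1 n) (prod_set Y 1 n) (prod_kernel W 1 n)) - (6 * K + 1) / \<alpha>0 * real n powr (3/4) * ln (real n))
        \<le> fb_error Y W n (M n) (f n) (\<psi> n)"
    if n: "n1 \<le> n" and fin: "sphere_packing_exp (ln (real (M n) / real (L n))) (prod_set X 1 n) (prod_set Y 1 n)
        (prod_kernel W 1 n) \<noteq> \<infinity>" for n
  proof -
    let ?E = "real_of_ereal (sphere_packing_exp (ln (real (M n) / real (L n)))
        (prod_set X 1 n) (prod_set Y 1 n) (prod_kernel W 1 n))"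
    let ?\<Lambda> = "ln (real n)" and ?P = "real n powr (2/3)"
    have n': "N ^ 3 \<le> n" "3 \<le> n" "(T1 + T2) ^ 12 \<le> real n"
      using n unfolding n1_def by (auto simp: nat_le_iff ceiling_le_iff)
    have n0n: "n0 \<le> n" using n \<open>n0 \<le> n1\<close> by simp
    define l where "l = nat \<lfloor>real n powr (1/3)\<rfloor>"
    note l = floor_cube_root[OF n'(1) N(1), folded l_def]
    have \<Lambda>: "1 \<le> ?\<Lambda>"
    proof -
      have "exp 1 \<le> real n" using e_less_272 n'(2) by linarith
      then show ?thesis using n'(2) by (simp add: ln_ge_iff)
    qed
    have P: "1 \<le> ?P" using n'(2) by (intro ge_one_powr_ge_zero) auto
    have PL: "1 \<le> ?P * ?\<Lambda>" "?P \<le> ?P * ?\<Lambda>" "?\<Lambda> \<le> ?P * ?\<Lambda>"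
      using mult_mono[OF P \<Lambda>] mult_left_mono[OF \<Lambda>, of ?P] mult_right_mono[OF P, of ?\<Lambda>] P \<Lambda> by auto
    have big: "(T1 + T2) * (?P * ?\<Lambda>) \<le> real n powr (3/4) * ?\<Lambda>"
    proof -
      have "T1 + T2 \<le> real n powr (1/12)"
      proof -
        have "(T1 + T2) ^ 12 \<le> (real n powr (1/12)) ^ 12"
          using n'(2,3) by (simp add: powr_power)
        then show ?thesis using T by (simp add: power_mono_iff)
      qed
      then have "(T1 + T2) * ?P \<le> real n powr (1/12) * ?P" by (intro mult_right_mono) auto
      also have "\<dots> = real n powr (3/4)" by (simp flip: powr_add)
      finally show ?thesis using \<Lambda> by (simp add: mult_right_mono flip: mult.assoc)
    qed
    define \<sigma> where "\<sigma> = real n / real l * C3 + 2 * real l ^ 2 + ln 4"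
    have ln4: "ln 4 \<le> (2::real)"
      using ln_le_minus_one[of "2::real"] ln_realpow[of "2::real" 2] by simp
    have \<sigma>: "\<sigma> \<le> (8 * C3 + 4) * (?P * ?\<Lambda>)"
    proof -
      have "\<sigma> \<le> 8 * ?P * C3 + 2 * ?P + 2 * ?P"
        unfolding \<sigma>_def using l C ln4 P by (intro add_mono mult_right_mono mult_left_mono) auto
      also have "\<dots> = (8 * C3 + 4) * ?P" by (simp add: algebra_simps)
      also have "\<dots> \<le> (8 * C3 + 4) * (?P * ?\<Lambda>)" using PL C by (intro mult_left_mono) auto
      finally show ?thesis .
    qed
    have blocks: "real n / real l * c \<le> 8 * c * ?P" if "0 \<le> c" for c
      using mult_right_mono[OF l(5) that] by (simp add: mult_ac)
    have rate': "real n * g \<alpha>0 + \<sigma> + real n / real l * ((K + 1) * ?\<Lambda>) \<le> ln (real (M n) / real (L n))"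
    proof -
      have "real n * g \<alpha>0 \<le> prod_capacity \<alpha>0 X Y W 1 n + K * ?\<Lambda>"
        using unif[rule_format, of n \<alpha>0 1] n0n \<alpha>0 by auto
      moreover have "real n / real l * ((K + 1) * ?\<Lambda>) \<le> 8 * (K + 1) * (?P * ?\<Lambda>)"
      proof -
        have "real n / real l * ((K + 1) * ?\<Lambda>) \<le> 8 * ((K + 1) * ?\<Lambda>) * ?P"
          using K_nonneg \<Lambda> by (intro blocks) auto
        then show ?thesis by (simp only: mult_ac)
      qed
      moreover have "K * ?\<Lambda> \<le> K * (?P * ?\<Lambda>)" using PL K_nonneg by (intro mult_left_mono) auto
      moreover have "T1 * (?P * ?\<Lambda>) \<le> (K + 1) * real n powr (3/4) * ?\<Lambda>"
      proof -
        have "T1 * (?P * ?\<Lambda>) \<le> (T1 + T2) * (?P * ?\<Lambda>)" using T PL by (intro mult_right_mono) auto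
        also have "\<dots> \<le> 1 * (real n powr (3/4) * ?\<Lambda>)" using big by simp
        also have "\<dots> \<le> (K + 1) * (real n powr (3/4) * ?\<Lambda>)" using K_nonneg \<Lambda> by (intro mult_right_mono) auto
        finally show ?thesis by (simp add: mult.assoc)
      qed
      moreover have "T1 * (?P * ?\<Lambda>) = (8 * C3 + 4) * (?P * ?\<Lambda>) + 8 * (K + 1) * (?P * ?\<Lambda>) + K * (?P * ?\<Lambda>)"
        by (simp add: T1_def algebra_simps)
      moreover have "prod_capacity \<alpha>0 X Y W 1 n + (K + 1) * real n powr (3/4) * ?\<Lambda> \<le> ln (real (M n) / real (L n))"
        using rate n0n by auto
      ultimately show ?thesis using \<sigma> by linarith
    qed
    have "1 / real l \<le> 1 - \<alpha>0"
    proof -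
      have "1 / (1 - \<alpha>0) \<le> real l" using N(4) l(1) by linarith
      then show ?thesis using \<alpha>0 l(1) N(1) by (simp add: field_simps)
    qed
    moreover have "1 \<le> l" "n0 \<le> l" "2 * C2 \<le> real l" using l(1) N by auto
    ultimately have "exp (- (?E + (K * ?\<Lambda> + \<sigma>) / \<alpha>0
      + real n / real l * ((K + 1) * ?\<Lambda> / \<alpha>0 + C1 / \<alpha>0^2 + C1 / \<alpha>0 + C3) + 2 * real l ^ 2 + ln 4))
      \<le> fb_error Y W n (M n) (f n) (\<psi> n)"
      using codes n'(2) sphere_packing_exp_real[OF fin] unif g K_nonneg rate' l(2,3) \<alpha>0
      by (intro fb_error_ge_blocks[OF channels, where ?n0.0 = n0 and g = g and G = G and M = "M n" and L = "L n"
              and K = K and ?\<alpha>0.0 = \<alpha>0 and n = n and l = l,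
            folded C1_def, folded C2_def, folded C3_def, folded \<sigma>_def])
        (auto simp: prod_capacity_def)
    moreover have "(K * ?\<Lambda> + \<sigma>) / \<alpha>0 + real n / real l * ((K + 1) * ?\<Lambda> / \<alpha>0 + C1 / \<alpha>0^2 + C1 / \<alpha>0 + C3)
        + 2 * real l ^ 2 + ln 4 \<le> (6 * K + 1) / \<alpha>0 * real n powr (3/4) * ?\<Lambda>"
    proof -
      have "K * ?\<Lambda> + \<sigma> \<le> (K + (8 * C3 + 4)) * (?P * ?\<Lambda>)"
        using \<sigma> mult_left_mono[OF PL(3) K_nonneg] by (simp add: distrib_right)
      then have "(K * ?\<Lambda> + \<sigma>) / \<alpha>0 \<le> (K + (8 * C3 + 4)) / \<alpha>0 * (?P * ?\<Lambda>)"
        using \<alpha>0 by (simp add: divide_right_mono)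
      moreover have "real n / real l * ((K + 1) * ?\<Lambda> / \<alpha>0 + C1 / \<alpha>0^2 + C1 / \<alpha>0 + C3) \<le> 8 * D * (?P * ?\<Lambda>)"
      proof -
        have "(C1 / \<alpha>0^2 + C1 / \<alpha>0 + C3) * 1 \<le> (C1 / \<alpha>0^2 + C1 / \<alpha>0 + C3) * ?\<Lambda>"
          using C \<alpha>0 \<Lambda> by (intro mult_left_mono) auto
        then have "(K + 1) * ?\<Lambda> / \<alpha>0 + C1 / \<alpha>0^2 + C1 / \<alpha>0 + C3 \<le> D * ?\<Lambda>"
          by (simp add: D_def distrib_right)
        then have "real n / real l * ((K + 1) * ?\<Lambda> / \<alpha>0 + C1 / \<alpha>0^2 + C1 / \<alpha>0 + C3) \<le> real n / real l * (D * ?\<Lambda>)"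
          by (intro mult_left_mono) auto
        also have "\<dots> \<le> 8 * (D * ?\<Lambda>) * ?P" using D \<Lambda> by (intro blocks) auto
        finally show ?thesis by (simp add: mult_ac)
      qed
      moreover have "2 * real l ^ 2 + ln 4 \<le> 4 * (?P * ?\<Lambda>)"
        using l(4) ln4 PL P by linarith
      moreover have "T2 * (?P * ?\<Lambda>) \<le> (6 * K + 1) / \<alpha>0 * real n powr (3/4) * ?\<Lambda>"
      proof -
        have "T2 * (?P * ?\<Lambda>) \<le> (T1 + T2) * (?P * ?\<Lambda>)" using T PL by (intro mult_right_mono) auto
        also have "\<dots> \<le> 1 * (real n powr (3/4) * ?\<Lambda>)" using big by simp
        \<comment> \<open>Since \<alpha>0 is below 1 and \<open>K\<close> is nonnegative, this
          coefficient is at least 1.\<close>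
        also have "\<dots> \<le> (6 * K + 1) / \<alpha>0 * (real n powr (3/4) * ?\<Lambda>)"
          using K_nonneg \<Lambda> \<alpha>0 by (intro mult_right_mono) auto
        finally show ?thesis by (simp add: mult.assoc)
      qed
      moreover have "T2 * (?P * ?\<Lambda>) = (K + (8 * C3 + 4)) / \<alpha>0 * (?P * ?\<Lambda>) + 8 * D * (?P * ?\<Lambda>) + 4 * (?P * ?\<Lambda>)"
        by (simp add: T2_def distrib_right)
      ultimately show ?thesis by linarith
    qed
    ultimately show ?thesis by (smt (verit) exp_le_cancel_iff)
  qed
  ultimately show ?thesis by blast
qed

end
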